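(* Let $V_0,V_1,V_2$ be super Hilbert spaces (all real or all complex), and let $L_{01}\subset \Pi V_0\oplus V_1$ and $L_{12}\subset \Pi V_1\oplus V_2$ be Lagrangian relations. Let $$u=\begin{pmatrix} u_{00} & u_{01} \\ u_{10} & u_{11} \end{pmatrix}\colon V_0^-\oplus V_1^+\to V_0^+\oplus V_1^-,\qquad v=\begin{pmatrix} v_{11} & v_{12} \\ v_{21} & v_{22} \end{pmatrix}\colon V_1^-\oplus V_2^+\to V_1^+\oplus V_2^-$$ be the unitaries with $L_{01}=\mathrm{graph}(u)$ and $L_{12}=\mathrm{graph}(v)$. Suppose that the operators $1-v_{11}u_{11}\colon V_1^+\to V_1^+$ and $1-u_{11}v_{11}\colon V_1^-\to V_1^-$ have closed range. Then the composition $L_{12}\circ L_{01}$ is a Lagrangian in $\Pi V_0\oplus V_2$, and hence the graph of a unitary transformation $$w\colon (\Pi V_0\oplus V_2)^+=V_0^-\oplus V_2^+\longrightarrow V_0^+\oplus V_2^-=(\Pi V_0\oplus V_2)^-.$$ This unitary is given by $$w=\begin{pmatrix} u_{00}+u_{01}Xv_{11}u_{10} & u_{01}Xv_{12} \\ v_{21}Yu_{10} & v_{22}+v_{21}Yu_{11}v_{12} \end{pmatrix},$$ where $X$ and $Y$ are the generalized inverses of $1-v_{11}u_{11}$ and $1-u_{11}v_{11}$, respectively.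
   Context: A super Hilbert space is a real or complex Hilbert space $V$ with an orthogonal decomposition $V=V^+\oplus V^-$; its grading operator $\Gamma$ is $\pm1$ on $V^\pm$, and $B(x,y)=\langle\Gamma x,y\rangle$. A subspace $L\subset V$ is $B$-isotropic if $B(x,y)=0$ for all $x,y\in L$. A Lagrangian is a $B$-isotropic subspace $L$ with $L+\Gamma L=V$ (equivalently $\Gamma L=L^\perp$). $\Pi V$ is the same Hilbert space with grading operator $-\Gamma$; thus $(\Pi V_0\oplus V_1)^+=V_0^-\oplus V_1^+$ and $(\Pi V_0\oplus V_1)^-=V_0^+\oplus V_1^-$. A Lagrangian relation between $V_0$ and $V_1$ is a Lagrangian $L\subset\Pi V_0\oplus V_1$. Every Lagrangian $L$ in a super Hilbert space $W$ is $\mathrm{graph}(u)=\{x+ux\mid x\in W^+\}$ for a unique unitary $u\colon W^+\to W^-$. The composition of Lagrangian relations is $$L_{12}\circ L_{01}=\{(x_0,x_2)\in\Pi V_0\oplus V_2\mid \exists x_1\in V_1:(x_0,x_1)\in L_{01},\ (x_1,x_2)\in L_{12}\}.$$ The generalized inverse of a bounded operator $A\colon V\to W$ between Hilbert spaces with closed range is the operator $X\colon W\to V$ with $\ker(X)=\mathrm{ran}(A)^\perp$ and $\mathrm{ran}(X)=\ker(A)^\perp$ such that $XA=1$ on $\ker(A)^\perp$ and $AX=1$ on $\mathrm{ran}(A)$. *)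

theory Defs
  imports "HOL-Analysis.Analysis"
begin

text \<open>
  Real and complex Hilbert spaces are treated uniformly, over a scalar field of the class below.
  The second axiom forces \<open>conj x = \<bar>x\<bar>\<^sup>2 / x\<close> for \<open>x \<noteq> 0\<close>; by the Gelfand--Mazur theorem \<open>real\<close> and
  \<open>complex\<close>, with the usual conjugation, are up to isomorphism the only instances.
\<close>

class real_or_complex = real_normed_field +
  fixes conj :: "'a \<Rightarrow> 'a"
  assumes conj_add: "conj (x + y) = conj x + conj y"
    and mult_conj: "x * conj x = (norm x)\<^sup>2 *\<^sub>R 1"

instantiation real :: real_or_complex
begin
definition conj_real :: "real \<Rightarrow> real" where "conj_real x = x"
instance by standard (simp_all add: conj_real_def power2_eq_square)
end

instantiation complex :: real_or_complex
begin
definition conj_complex :: "complex \<Rightarrow> complex" where "conj_complex = cnj"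
instance by standard (simp_all add: conj_complex_def complex_norm_square[symmetric] scaleR_conv_of_real)
end

text \<open>
  The norm, and with it topology and completeness, comes from the class \<^class>\<open>banach\<close>; the axioms
  tie it to the inner product, which is linear in its first argument.
\<close>

locale hilbert_space = vector_space scale
  for scale :: "'k::real_or_complex \<Rightarrow> 'v::banach \<Rightarrow> 'v" +
  fixes inner_prod :: "'v \<Rightarrow> 'v \<Rightarrow> 'k"
  assumes scale_of_real: "scale (of_real r) x = r *\<^sub>R x"
    and inner_prod_add_left: "inner_prod (x + y) z = inner_prod x z + inner_prod y z"
    and inner_prod_scale_left: "inner_prod (scale c x) y = c * inner_prod x y"
    and inner_prod_commute: "inner_prod y x = conj (inner_prod x y)"
    and inner_prod_self: "inner_prod x x = of_real ((norm x)\<^sup>2)"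

lemma hilbert_space_real:
  "hilbert_space scaleR (inner :: 'v::{real_inner, banach} \<Rightarrow> 'v \<Rightarrow> real)"
  by unfold_locales
    (simp_all add: algebra_simps inner_add_left inner_commute conj_real_def power2_norm_eq_inner)

record ('k, 'v) super_space =
  smul :: "'k \<Rightarrow> 'v \<Rightarrow> 'v"
  ip :: "'v \<Rightarrow> 'v \<Rightarrow> 'k"
  pos :: "'v set"
  neg :: "'v set"

definition super_hilbert :: "('k::real_or_complex, 'v::banach) super_space \<Rightarrow> bool" where
  "super_hilbert V \<longleftrightarrow>
     hilbert_space (smul V) (ip V) \<and>
     module.subspace (smul V) (pos V) \<and> module.subspace (smul V) (neg V) \<and>
     (\<forall>x\<in>pos V. \<forall>y\<in>neg V. ip V x y = 0) \<and>
     (\<forall>x. \<exists>p\<in>pos V. \<exists>n\<in>neg V. x = p + n)"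

definition grading :: "('k::real_or_complex, 'v::banach) super_space \<Rightarrow> 'v \<Rightarrow> 'v" where
  "grading V x = (THE y. \<exists>p\<in>pos V. \<exists>n\<in>neg V. x = p + n \<and> y = p - n)"

definition grading_form :: "('k::real_or_complex, 'v::banach) super_space \<Rightarrow> 'v \<Rightarrow> 'v \<Rightarrow> 'k" where
  "grading_form V x y = ip V (grading V x) y"

definition isotropic :: "('k::real_or_complex, 'v::banach) super_space \<Rightarrow> 'v set \<Rightarrow> bool" where
  "isotropic V L \<longleftrightarrow> module.subspace (smul V) L \<and> (\<forall>x\<in>L. \<forall>y\<in>L. grading_form V x y = 0)"

definition lagrangian :: "('k::real_or_complex, 'v::banach) super_space \<Rightarrow> 'v set \<Rightarrow> bool" where
  "lagrangian V L \<longleftrightarrow> isotropic V L \<and> {x + grading V y | x y. x \<in> L \<and> y \<in> L} = UNIV"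

definition parity :: "('k, 'v) super_space \<Rightarrow> ('k, 'v) super_space" ("\<Pi>") where
  "\<Pi> V = V\<lparr>pos := neg V, neg := pos V\<rparr>"

definition direct_sum ::
  "('k::real_or_complex, 'v) super_space \<Rightarrow> ('k, 'w) super_space \<Rightarrow> ('k, 'v \<times> 'w) super_space"
  (infixr "\<oplus>" 70) where
  "V \<oplus> W = \<lparr>smul = (\<lambda>c (x, y). (smul V c x, smul W c y)),
            ip = (\<lambda>(x, y) (x', y'). ip V x x' + ip W y y'),
            pos = pos V \<times> pos W, neg = neg V \<times> neg W\<rparr>"

definition lagrangian_relation ::
  "('k::real_or_complex, 'v::banach) super_space \<Rightarrow> ('k, 'w::banach) super_space
    \<Rightarrow> ('v \<times> 'w) set \<Rightarrow> bool" where
  "lagrangian_relation V W L \<longleftrightarrow> lagrangian (\<Pi> V \<oplus> W) L"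

text \<open>
  Operators between subspaces \<open>S\<close> of \<open>V\<close> and \<open>T\<close> of \<open>W\<close> are functions on the whole types
  of which only the values on \<open>S\<close> matter.
\<close>

definition linear_op ::
  "('k, 'v::ab_group_add) super_space \<Rightarrow> 'v set \<Rightarrow> ('k, 'w::ab_group_add) super_space \<Rightarrow> 'w set
    \<Rightarrow> ('v \<Rightarrow> 'w) \<Rightarrow> bool" where
  "linear_op V S W T f \<longleftrightarrow>
     f ` S \<subseteq> T \<and>
     (\<forall>x\<in>S. \<forall>y\<in>S. f (x + y) = f x + f y) \<and>
     (\<forall>c. \<forall>x\<in>S. f (smul V c x) = smul W c (f x))"

definition bounded_op ::
  "('k, 'v::real_normed_vector) super_space \<Rightarrow> 'v set \<Rightarrow> ('k, 'w::real_normed_vector) super_space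
    \<Rightarrow> 'w set \<Rightarrow> ('v \<Rightarrow> 'w) \<Rightarrow> bool" where
  "bounded_op V S W T f \<longleftrightarrow> linear_op V S W T f \<and> (\<exists>K. \<forall>x\<in>S. norm (f x) \<le> K * norm x)"

definition unitary_op ::
  "('k, 'v::ab_group_add) super_space \<Rightarrow> 'v set \<Rightarrow> ('k, 'w::ab_group_add) super_space \<Rightarrow> 'w set
    \<Rightarrow> ('v \<Rightarrow> 'w) \<Rightarrow> bool" where
  "unitary_op V S W T f \<longleftrightarrow>
     linear_op V S W T f \<and> f ` S = T \<and> (\<forall>x\<in>S. \<forall>y\<in>S. ip W (f x) (f y) = ip V x y)"

definition graph :: "('k, 'v::ab_group_add) super_space \<Rightarrow> ('v \<Rightarrow> 'v) \<Rightarrow> 'v set" where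
  "graph V f = {x + f x | x. x \<in> pos V}"

definition block ::
  "('a \<Rightarrow> 'c) \<Rightarrow> ('b \<Rightarrow> 'c) \<Rightarrow> ('a \<Rightarrow> 'd) \<Rightarrow> ('b \<Rightarrow> 'd)
    \<Rightarrow> 'a \<times> 'b \<Rightarrow> 'c::ab_group_add \<times> 'd::ab_group_add" where
  "block a b c d = (\<lambda>(x, y). (a x + b y, c x + d y))"

definition orth_in :: "('k::zero, 'v) super_space \<Rightarrow> 'v set \<Rightarrow> 'v set \<Rightarrow> 'v set" where
  "orth_in V S A = {x \<in> S. \<forall>y\<in>A. ip V x y = 0}"

definition generalized_inverse ::
  "('k::real_or_complex, 'v::banach) super_space \<Rightarrow> 'v set \<Rightarrow> ('k, 'w::banach) super_space
    \<Rightarrow> 'w set \<Rightarrow> ('v \<Rightarrow> 'w) \<Rightarrow> ('w \<Rightarrow> 'v) \<Rightarrow> bool" where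
  "generalized_inverse V S W T A X \<longleftrightarrow>
     bounded_op W T V S X \<and>
     {y \<in> T. X y = 0} = orth_in W T (A ` S) \<and>
     X ` T = orth_in V S {x \<in> S. A x = 0} \<and>
     (\<forall>x \<in> orth_in V S {x \<in> S. A x = 0}. X (A x) = x) \<and>
     (\<forall>y \<in> A ` S. A (X y) = y)"

lemma super_hilbert_parity:
  assumes "super_hilbert V"
  shows "super_hilbert (\<Pi> V)"
proof -
  interpret hilbert_space "smul V" "ip V"
    using assms by (simp add: super_hilbert_def)
  have "conj (0::'a) = 0"
    using conj_add[of 0 "0::'a"] by simp
  then show ?thesis
    using assms unfolding super_hilbert_def parity_def
    by simp (metis add.commute inner_prod_commute)
qed

lemma grading_eq:
  assumes "super_hilbert V" "p \<in> pos V" "n \<in> neg V"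
  shows "grading V (p + n) = p - n"
proof -
  interpret hilbert_space "smul V" "ip V"
    using assms by (simp add: super_hilbert_def)
  have sub: "subspace (pos V)" "subspace (neg V)"
    and orth: "\<And>x y. x \<in> pos V \<Longrightarrow> y \<in> neg V \<Longrightarrow> ip V x y = 0"
    using assms(1) by (auto simp: super_hilbert_def)
  have "p' = p \<and> n' = n" if "p' \<in> pos V" "n' \<in> neg V" "p + n = p' + n'" for p' n'
  proof -
    have eq: "p' - p = n - n'"
      using that(3) by (metis add_diff_cancel_left' add_diff_eq diff_diff_eq2 add.commute)
    have "ip V (p' - p) (n - n') = 0"
      using that assms(2,3) sub by (intro orth) (auto intro: subspace_diff)
    then have "p' - p = 0"
      using inner_prod_self[of "p' - p"] eq by simp
    then show ?thesis using eq by simp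
  qed
  then show ?thesis
    unfolding grading_def using assms(2,3) by (intro the_equality) blast+
qed

lemma grading_parity:
  assumes "super_hilbert V"
  shows "grading (\<Pi> V) x = - grading V x"
proof -
  obtain p n where pn: "p \<in> pos V" "n \<in> neg V" "x = p + n"
    using assms unfolding super_hilbert_def by blast
  have "grading (\<Pi> V) (n + p) = n - p"
    using pn by (intro grading_eq super_hilbert_parity assms) (simp_all add: parity_def)
  then show ?thesis
    using grading_eq[OF assms pn(1,2)] pn(3) by (simp add: add.commute)
qed

lemma super_hilbert_direct_sum:
  assumes "super_hilbert V" "super_hilbert W"
  shows "super_hilbert (V \<oplus> W)"
proof -
  interpret V: hilbert_space "smul V" "ip V"
    using assms by (simp add: super_hilbert_def)
  interpret W: hilbert_space "smul W" "ip W"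
    using assms by (simp add: super_hilbert_def)
  interpret hilbert_space "smul (V \<oplus> W)" "ip (V \<oplus> W)"
    by unfold_locales
      (auto simp: direct_sum_def algebra_simps V.scale_of_real W.scale_of_real
        V.scale_right_distrib W.scale_right_distrib V.scale_left_distrib W.scale_left_distrib
        V.inner_prod_add_left W.inner_prod_add_left V.inner_prod_scale_left W.inner_prod_scale_left
        V.inner_prod_self W.inner_prod_self norm_Pair conj_add
        V.inner_prod_commute[symmetric] W.inner_prod_commute[symmetric] simp del: of_real_power)
  have sum: "\<exists>p\<in>pos (V \<oplus> W). \<exists>n\<in>neg (V \<oplus> W). z = p + n" for z
  proof -
    obtain p n p' n' where "p \<in> pos V" "n \<in> neg V" "fst z = p + n"
      "p' \<in> pos W" "n' \<in> neg W" "snd z = p' + n'"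
      using assms unfolding super_hilbert_def by metis
    then show ?thesis
      by (intro bexI[of _ "(p, p')"] bexI[of _ "(n, n')"]) (auto simp: direct_sum_def prod_eq_iff)
  qed
  have "subspace (pos (V \<oplus> W))" "subspace (neg (V \<oplus> W))"
    using assms unfolding super_hilbert_def subspace_def V.subspace_def W.subspace_def
    by (simp_all add: direct_sum_def zero_prod_def)
  moreover have "ip (V \<oplus> W) x y = 0" if "x \<in> pos (V \<oplus> W)" "y \<in> neg (V \<oplus> W)" for x y
    using assms that unfolding super_hilbert_def by (auto simp: direct_sum_def)
  ultimately show ?thesis
    using sum hilbert_space_axioms unfolding super_hilbert_def by blast
qed

end

theory Submission
  imports Defs
begin

text \<open>
  Writing \<open>x\<^sub>1 = p + n\<close>, a point of the composition amounts to a solution of \<open>n = u\<^sub>1\<^sub>0 a + u\<^sub>1\<^sub>1 p\<close>,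
  \<open>p = v\<^sub>1\<^sub>1 n + v\<^sub>1\<^sub>2 c\<close>, that is of \<open>(1 - v\<^sub>1\<^sub>1 u\<^sub>1\<^sub>1) p = v\<^sub>1\<^sub>1 u\<^sub>1\<^sub>0 a + v\<^sub>1\<^sub>2 c\<close>. If \<open>p\<close> is fixed by
  the contraction \<open>T = v\<^sub>1\<^sub>1 u\<^sub>1\<^sub>1\<close>, no norm is lost, so \<open>u\<^sub>0\<^sub>1 p = 0\<close> and \<open>v\<^sub>2\<^sub>1 u\<^sub>1\<^sub>1 p = 0\<close>; hence the
  right-hand side is orthogonal to \<open>ker (1 - T)\<close> and different solutions give the same output. A
  contraction and its adjoint have the same fixed vectors, so the closed range of \<open>1 - T\<close> is the
  orthogonal complement of \<open>ker (1 - T)\<close>, and the system is solvable for all \<open>(a, c)\<close>. Thus the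
  composition is the graph of an isometry. Its surjectivity is the same argument for the inverse
  unitaries, because the adjoint of an operator with closed range has closed range.
\<close>

section \<open>Projections and uniform boundedness\<close>

text \<open>A real inner product as an explicit form on a Banach space whose norm it induces. It is
  interpreted with \<open>polar\<close>, so that real and complex scalars share one
  analysis.\<close>

locale real_inner_form =
  fixes r :: "'v::banach \<Rightarrow> 'v \<Rightarrow> real"
  assumes add_left: "r (x + y) z = r x z + r y z"
    and scaleR_left: "r (c *\<^sub>R x) y = c * r x y"
    and commute: "r x y = r y x"
    and self: "r x x = (norm x)\<^sup>2"
begin

lemma add_right: "r z (x + y) = r z x + r z y"
  by (metis add_left commute)

lemma scaleR_right: "r x (c *\<^sub>R y) = c * r x y"
  by (metis scaleR_left commute)

lemma minus_left: "r (- x) y = - r x y"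
  using scaleR_left[of "-1" x y] by simp

lemma diff_left: "r (x - y) z = r x z - r y z"
  using add_left[of x "- y" z] by (simp add: minus_left)

lemma diff_right: "r z (x - y) = r z x - r z y"
  by (metis diff_left commute)

lemma zero_left [simp]: "r 0 x = 0"
  using diff_left[of 0 0 x] by simp

lemma zero_right [simp]: "r x 0 = 0"
  by (metis zero_left commute)

lemma norm_diff_square: "(norm (x - y))\<^sup>2 = (norm x)\<^sup>2 - 2 * r x y + (norm y)\<^sup>2"
  using commute[of x y] by (simp flip: self add: diff_left diff_right)

lemma norm_add_square: "(norm (x + y))\<^sup>2 = (norm x)\<^sup>2 + 2 * r x y + (norm y)\<^sup>2"
  using commute[of x y] by (simp flip: self add: add_left add_right)

text \<open>For unit vectors the bound is the nonnegativity of the squared norm of their difference;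
  replacing \<open>x\<close> by \<open>- x\<close> gives the absolute value.\<close>

lemma cauchy_schwarz: "\<bar>r x y\<bar> \<le> norm x * norm y"
proof (cases "x = 0 \<or> y = 0")
  case False
  have le: "r a b \<le> norm a * norm b" if "a \<noteq> 0" "b \<noteq> 0" for a b
  proof -
    have "0 \<le> (norm (a /\<^sub>R norm a - b /\<^sub>R norm b))\<^sup>2" by simp
    also have "\<dots> = 2 - 2 * (r a b / (norm a * norm b))"
      using that unfolding norm_diff_square
      by (simp add: scaleR_left scaleR_right field_simps)
    finally have "r a b / (norm a * norm b) \<le> 1" by simp
    then show ?thesis using that by (simp add: divide_le_eq)
  qed
  show ?thesis
    using le[of x y] le[of "- x" y] False by (auto simp: minus_left)
qed auto

lemma bounded_linear_left: "bounded_linear (\<lambda>x. r x y)"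
  by (rule bounded_linear_intro[where K = "norm y"])
     (use cauchy_schwarz in \<open>auto simp: add_left scaleR_left\<close>)

text \<open>A sequence in \<open>M\<close> minimising the distance to \<open>x\<close> is Cauchy by
  the parallelogram law, and its limit is the foot of the perpendicular.\<close>

lemma projection:
  assumes "closed M" "subspace M"
  obtains m where "m \<in> M" "\<And>y. y \<in> M \<Longrightarrow> r (x - m) y = 0"
proof -
  define d where "d = infdist x M"
  have ne: "M \<noteq> {}" using assms(2) subspace_0 by blast
  have d: "d \<le> norm (x - m)" if "m \<in> M" for m
    using infdist_le[OF that, of x] by (simp add: d_def dist_norm)
  have d0: "0 \<le> d" by (simp add: d_def infdist_nonneg)
  have "\<exists>m\<in>M. norm (x - m) < d + 1 / real (Suc n)" for n
  proof (rule ccontr)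
    assume "\<not> ?thesis"
    then have "d + 1 / real (Suc n) \<le> infdist x M"
      using ne by (auto simp: infdist_def dist_norm not_less intro!: cINF_greatest)
    then show False by (simp add: d_def)
  qed
  then obtain f where fM: "\<And>n. f n \<in> M" and f: "\<And>n. norm (x - f n) < d + 1 / real (Suc n)"
    by metis
  have lim: "(\<lambda>n. norm (x - f n)) \<longlonglongrightarrow> d"
  proof (rule tendsto_sandwich[OF _ _ tendsto_const])
    show "(\<lambda>n. d + 1 / real (Suc n)) \<longlonglongrightarrow> d"
      using tendsto_add[OF tendsto_const LIMSEQ_inverse_real_of_nat, of d]
      by (simp add: divide_inverse)
  qed (use d fM f[THEN less_imp_le] in \<open>auto\<close>)
  \<comment> \<open>The midpoint of \<open>f m\<close> and \<open>f n\<close> lies in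
    \<open>M\<close>, hence has distance at least \<open>d\<close> from \<open>x\<close>; insert
    this into the parallelogram law for \<open>x - f m\<close> and \<open>x - f n\<close>.\<close>
  have par: "(norm (f m - f n))\<^sup>2 \<le> 2 * ((norm (x - f m))\<^sup>2 - d\<^sup>2) + 2 * ((norm (x - f n))\<^sup>2 - d\<^sup>2)"
    for m n
  proof -
    have "(1/2) *\<^sub>R (f m + f n) \<in> M"
      using assms(2) fM by (intro subspace_scale subspace_add) auto
    then have "d\<^sup>2 \<le> (norm (x - (1/2) *\<^sub>R (f m + f n)))\<^sup>2"
      using d d0 by (intro power_mono) auto
    moreover have "(norm ((x - f m) + (x - f n)))\<^sup>2 = (norm (2 *\<^sub>R (x - (1/2) *\<^sub>R (f m + f n))))\<^sup>2"
      by (simp add: algebra_simps scaleR_2)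
    ultimately have "4 * d\<^sup>2 \<le> (norm ((x - f m) + (x - f n)))\<^sup>2"
      by (simp add: power_mult_distrib)
    moreover have "(norm (f m - f n))\<^sup>2 = (norm ((x - f m) - (x - f n)))\<^sup>2"
      by (simp add: norm_minus_commute)
    ultimately show ?thesis
      unfolding norm_add_square norm_diff_square[of "x - f m" "x - f n"] by argo
  qed
  have "Cauchy f"
  proof (rule CauchyI)
    fix e :: real assume "0 < e"
    have "(\<lambda>n. (norm (x - f n))\<^sup>2 - d\<^sup>2) \<longlonglongrightarrow> d\<^sup>2 - d\<^sup>2"
      by (intro tendsto_intros lim)
    then have "\<forall>\<^sub>F n in sequentially. (norm (x - f n))\<^sup>2 - d\<^sup>2 < e\<^sup>2 / 4"
      using \<open>0 < e\<close> by (intro order_tendstoD) auto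
    then obtain N where N: "\<And>n. n \<ge> N \<Longrightarrow> (norm (x - f n))\<^sup>2 - d\<^sup>2 < e\<^sup>2 / 4"
      by (auto simp: eventually_sequentially)
    have "norm (f m - f n) < e" if "m \<ge> N" "n \<ge> N" for m n
    proof (rule power_less_imp_less_base)
      show "(norm (f m - f n))\<^sup>2 < e\<^sup>2" using par[of m n] N[OF that(1)] N[OF that(2)] \<open>0 < e\<close> by argo
    qed (use \<open>0 < e\<close> in simp)
    then show "\<exists>N. \<forall>m\<ge>N. \<forall>n\<ge>N. norm (f m - f n) < e" by blast
  qed
  then obtain l where l: "f \<longlonglongrightarrow> l" using Cauchy_convergent convergent_def by blast
  have lM: "l \<in> M" using assms(1) fM l closed_sequentially by blast
  have "(\<lambda>n. norm (x - f n)) \<longlonglongrightarrow> norm (x - l)" by (intro tendsto_intros l)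
  then have nl: "norm (x - l) = d" using lim LIMSEQ_unique by blast
  have "r (x - l) y = 0" if "y \<in> M" for y
  proof (cases "y = 0")
    case False
    \<comment> \<open>This \<open>t\<close> minimises the norm of
      \<open>(x - l) - t *\<^sub>R y\<close>. Since \<open>l\<close> is already nearest, moving by
      it cannot help, which forces the pairing to vanish.\<close>
    define t where "t = r (x - l) y / (norm y)\<^sup>2"
    have "l + t *\<^sub>R y \<in> M" using assms(2) lM that by (intro subspace_add subspace_scale)
    then have "d\<^sup>2 \<le> (norm ((x - l) - t *\<^sub>R y))\<^sup>2"
      using d[of "l + t *\<^sub>R y"] d0 by (intro power_mono) (auto simp: algebra_simps)
    then have "2 * t * r (x - l) y \<le> t\<^sup>2 * (norm y)\<^sup>2"
      using nl by (simp add: norm_diff_square[of "x - l"] scaleR_right power_mult_distrib)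
    then have "(r (x - l) y)\<^sup>2 \<le> 0"
      using False by (simp add: t_def power_divide power2_eq_square field_simps)
    then show ?thesis by simp
  qed simp
  then show ?thesis using lM that by blast
qed

text \<open>
  Baire-free gliding hump: when passing from \<open>z\<close> to either \<open>z\<close> or \<open>z + \<epsilon> y / \<parallel>y\<parallel>\<close> one can reach
  \<open>\<bar>r z y\<bar> \<ge> \<epsilon> \<parallel>y\<parallel> / 2\<close>, and with \<open>\<epsilon> = 4\<^sup>-\<^sup>n\<close> the later corrections do not destroy this.
\<close>

lemma uniform_boundedness:
  assumes "closed M" "subspace M" "Y \<subseteq> M"
    and ptw: "\<And>x. x \<in> M \<Longrightarrow> \<exists>C. \<forall>y\<in>Y. \<bar>r x y\<bar> \<le> C"
  obtains K where "\<And>y. y \<in> Y \<Longrightarrow> norm y \<le> K"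
proof (rule ccontr)
  assume "\<not> thesis"
  then have "\<And>K. \<exists>y\<in>Y. K < norm y"
    using that by (metis not_less)
  \<comment> \<open>The 6 is 1 / (1/2 - 1/3): later steps take at most
    \<open>norm (y n) / (3 * 4 ^ n)\<close> from a pairing of size
    \<open>norm (y n) / (2 * 4 ^ n)\<close>, so more than \<open>n + 1\<close> survives.\<close>
  then obtain y where yY: "\<And>n. y n \<in> Y" and y: "\<And>n::nat. 6 * (4 ^ n * (real n + 1)) < norm (y n)"
    using choice[of "\<lambda>n z. z \<in> Y \<and> 6 * (4 ^ n * (real n + 1)) < norm z"] by blast
  have yp: "0 < norm (y n)" for n
    by (rule le_less_trans[OF _ y[of n]]) simp
  define step where "step n z = (if \<bar>r z (y n)\<bar> \<ge> norm (y n) / (2 * 4 ^ n) then 0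
      else (1 / (4 ^ n * norm (y n))) *\<^sub>R y n)" for n z
  define x where "x = rec_nat 0 (\<lambda>n z. z + step n z)"
  have x0: "x 0 = 0" and xS: "x (Suc n) = x n + step n (x n)" for n by (auto simp: x_def)
  have stepM: "step n z \<in> M" for n z
    using assms(2,3) yY by (auto simp: step_def intro!: subspace_scale subspace_0)
  have xM: "x n \<in> M" for n
    by (induction n) (use assms(2) stepM in \<open>auto simp: x0 xS subspace_0 intro: subspace_add\<close>)
  have nstep: "norm (step n z) \<le> (1/4) ^ n" for n z
    using yp[of n] by (simp add: step_def field_simps)
  \<comment> \<open>A pairing below the threshold in absolute value is raised by exactly twice the
    threshold, so it ends above it.\<close>
  have big: "\<bar>r (x (Suc n)) (y n)\<bar> \<ge> norm (y n) / (2 * 4 ^ n)" for n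
  proof (cases "\<bar>r (x n) (y n)\<bar> \<ge> norm (y n) / (2 * 4 ^ n)")
    case False
    then have "r (x (Suc n)) (y n) = r (x n) (y n) + norm (y n) / 4 ^ n"
      using yp[of n] by (simp add: xS step_def add_left scaleR_left self power2_eq_square)
    moreover have "norm (y n) / 4 ^ n = 2 * (norm (y n) / (2 * 4 ^ n))" by simp
    ultimately show ?thesis using False by linarith
  qed (simp add: xS step_def)
  have xsum: "x (Suc n + k) - x (Suc n) = (\<Sum>j<k. step (Suc n + j) (x (Suc n + j)))" for n k
    by (induction k) (simp_all add: xS)
  have summ: "summable (\<lambda>n. step n (x n))"
    by (rule summable_comparison_test'[where g = "\<lambda>n. (1/4::real) ^ n"])
       (use nstep in \<open>auto intro: summable_geometric\<close>)
  have xs: "x n = (\<Sum>j<n. step j (x j))" for n by (induction n) (auto simp: x0 xS)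
  obtain l where l: "x \<longlonglongrightarrow> l"
    using summable_LIMSEQ[OF summ] by (simp flip: xs)
  have lM: "l \<in> M" using assms(1) xM l closed_sequentially by blast
  \<comment> \<open>The steps with index greater than \<open>n\<close> are dominated by the
    geometric tail (1/4)^(n+1) / (1 - 1/4).\<close>
  have tail: "norm (l - x (Suc n)) \<le> (1/4) ^ n / 3" for n
  proof (rule LIMSEQ_le_const2)
    show "(\<lambda>k. norm (x (Suc n + k) - x (Suc n))) \<longlonglongrightarrow> norm (l - x (Suc n))"
      using LIMSEQ_ignore_initial_segment[OF l, of "Suc n"]
      by (intro tendsto_intros) (simp add: add.commute)
    have "norm (x (Suc n + k) - x (Suc n)) \<le> (1/4) ^ n / 3" for k
    proof -
      have "norm (x (Suc n + k) - x (Suc n)) \<le> (\<Sum>j<k. (1/4) ^ (Suc n + j))"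
        unfolding xsum by (intro sum_norm_le nstep)
      also have "\<dots> = (1/4) ^ Suc n * (\<Sum>j<k. (1/4) ^ j)"
        by (simp add: power_add sum_distrib_left)
      also have "\<dots> = (1/4) ^ n / 3 * (1 - (1/4) ^ k)"
        by (subst sum_gp_strict) (simp add: field_simps)
      also have "\<dots> \<le> (1/4) ^ n / 3 * 1"
        by (intro mult_left_mono) auto
      finally show ?thesis by simp
    qed
    then show "\<exists>N. \<forall>k\<ge>N. norm (x (Suc n + k) - x (Suc n)) \<le> (1/4) ^ n / 3" by blast
  qed
  obtain C where C: "\<And>z. z \<in> Y \<Longrightarrow> \<bar>r l z\<bar> \<le> C" using ptw[OF lM] by blast
  have "real n + 1 < C" for n
  proof -
    have "\<bar>r (l - x (Suc n)) (y n)\<bar> \<le> (1/4) ^ n / 3 * norm (y n)"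
      by (rule order_trans[OF cauchy_schwarz]) (use tail yp in \<open>intro mult_right_mono; auto\<close>)
    moreover have "(1/4::real) ^ n / 3 * norm (y n) = norm (y n) / (3 * 4 ^ n)"
      by (simp add: power_divide)
    ultimately have "norm (y n) / (2 * 4 ^ n) - norm (y n) / (3 * 4 ^ n) \<le> \<bar>r l (y n)\<bar>"
      using big[of n] diff_left[of l "x (Suc n)" "y n"] by linarith
    moreover have "norm (y n) / (2 * 4 ^ n) - norm (y n) / (3 * 4 ^ n) = norm (y n) / (6 * 4 ^ n)"
      by (simp add: field_simps)
    moreover have "real n + 1 < norm (y n) / (6 * 4 ^ n)"
      using y[of n] by (simp add: field_simps)
    ultimately show ?thesis using C[OF yY[of n]] by linarith
  qed
  then show False by (metis add_pos_nonneg less_asym' reals_Archimedean2 less_add_one less_trans)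
qed

end

section \<open>Contractions and their adjoints\<close>

text \<open>The adjoint \<open>T'\<close> on \<open>P\<close> is given rather than constructed: in
  the application it is a product of blocks of the inverse unitaries. Only real linearity is
  recorded, to match the real form \<open>r\<close>.\<close>

locale contraction_pair = real_inner_form r for r :: "'v::banach \<Rightarrow> 'v \<Rightarrow> real" +
  fixes P :: "'v set" and T T' :: "'v \<Rightarrow> 'v"
  assumes closed_P: "closed P" and subspace_P: "subspace P"
    and T_in: "x \<in> P \<Longrightarrow> T x \<in> P" and T'_in: "x \<in> P \<Longrightarrow> T' x \<in> P"
    and T_add: "x \<in> P \<Longrightarrow> y \<in> P \<Longrightarrow> T (x + y) = T x + T y"
    and T_scaleR: "x \<in> P \<Longrightarrow> T (c *\<^sub>R x) = c *\<^sub>R T x"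
    and T'_add: "x \<in> P \<Longrightarrow> y \<in> P \<Longrightarrow> T' (x + y) = T' x + T' y"
    and T'_scaleR: "x \<in> P \<Longrightarrow> T' (c *\<^sub>R x) = c *\<^sub>R T' x"
    and adjoint: "x \<in> P \<Longrightarrow> y \<in> P \<Longrightarrow> r (T x) y = r x (T' y)"
    and T_norm: "x \<in> P \<Longrightarrow> norm (T x) \<le> norm x"
    and T'_norm: "x \<in> P \<Longrightarrow> norm (T' x) \<le> norm x"
begin

text \<open>The hypotheses are symmetric in \<open>T\<close> and \<open>T'\<close>, so each result
  below may be read for the adjoint as well.\<close>

lemma swap: "contraction_pair r P T' T"
  by unfold_locales
    (simp_all add: closed_P subspace_P T_in T'_in T_add T'_add T_scaleR T'_scaleR T_norm T'_norm
      commute[of "T' _"] adjoint[symmetric] commute[of "T _"])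

text \<open>The kernel of 1 - T and its orthogonal complement inside \<open>P\<close>. The
  complement will be the range of 1 - T as soon as that range is closed.\<close>

definition fixed_space :: "'v set" where "fixed_space = {x \<in> P. T x = x}"
definition fixed_perp :: "'v set" where "fixed_perp = {x \<in> P. \<forall>k\<in>fixed_space. r x k = 0}"

text \<open>For fixed \<open>x\<close> the cross term \<open>r (T' x) x\<close> equals
  \<open>r x (T x)\<close>, the squared norm of \<open>x\<close>, so the squared distance from
  \<open>T' x\<close> to \<open>x\<close> is
  \<open>(norm (T' x))\<^sup>2 - (norm x)\<^sup>2\<close>, which is at most 0.\<close>

lemma fixed_imp: "x \<in> P \<Longrightarrow> T x = x \<Longrightarrow> T' x = x"
proof -
  assume x: "x \<in> P" "T x = x"
  have "(norm (T' x - x))\<^sup>2 = (norm (T' x))\<^sup>2 - (norm x)\<^sup>2"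
    unfolding norm_diff_square using adjoint[OF x(1,1)] x(2) commute[of x "T' x"] self[of x] by simp
  also have "\<dots> \<le> 0" using T'_norm[OF x(1)] by simp
  finally show ?thesis by simp
qed

lemma fixed_space_swap: "contraction_pair.fixed_space P T' = fixed_space"
proof -
  interpret s: contraction_pair r P T' T by (rule swap)
  show ?thesis using fixed_imp s.fixed_imp by (auto simp: fixed_space_def s.fixed_space_def)
qed

lemma fixed_perp_swap: "contraction_pair.fixed_perp r P T' = fixed_perp"
proof -
  interpret s: contraction_pair r P T' T by (rule swap)
  show ?thesis by (simp add: fixed_perp_def s.fixed_perp_def fixed_space_swap)
qed

lemma T_diff: "x \<in> P \<Longrightarrow> y \<in> P \<Longrightarrow> T (x - y) = T x - T y"
  using T_add[of x "-1 *\<^sub>R y"] T_scaleR[of y "-1"] subspace_P subspace_neg by force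

lemma diff_in: "x \<in> P \<Longrightarrow> x - T x \<in> P"
  using subspace_P T_in subspace_diff by blast

lemma subspace_fixed_perp: "subspace fixed_perp"
  using subspace_P unfolding subspace_def fixed_perp_def by (auto simp: add_left scaleR_left)

lemma closed_fixed_perp: "closed fixed_perp"
proof -
  have "fixed_perp = P \<inter> (\<Inter>k\<in>fixed_space. (\<lambda>x. r x k) -` {0})" by (auto simp: fixed_perp_def)
  moreover have "closed ((\<lambda>x. r x k) -` {0})" for k
    by (intro continuous_closed_vimage linear_continuous_at bounded_linear_left) simp
  ultimately show ?thesis by (metis closed_INT closed_Int closed_P)
qed

lemma fixed_perp_fixed_space: "x \<in> fixed_perp \<Longrightarrow> x \<in> fixed_space \<Longrightarrow> x = 0"
  using self[of x] by (auto simp: fixed_perp_def)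

lemma adjoint_diff: "x \<in> P \<Longrightarrow> y \<in> P \<Longrightarrow> r (x - T x) y = r x (y - T' y)"
  by (simp add: diff_left diff_right adjoint)

text \<open>Moving 1 - T across the form turns it into 1 - T', which kills
  \<open>fixed_space\<close> because fixed vectors of \<open>T\<close> are fixed by
  \<open>T'\<close>.\<close>

lemma range_subset: "x \<in> P \<Longrightarrow> x - T x \<in> fixed_perp"
  using fixed_imp diff_in by (auto simp: fixed_perp_def fixed_space_def adjoint_diff)

text \<open>Testing orthogonality against the image of \<open>z - T' z\<close> shows that this
  vector has norm 0, so \<open>z\<close> is fixed by \<open>T'\<close> and therefore by
  \<open>T\<close>.\<close>

lemma perp_range:
  assumes "z \<in> P" "\<And>x. x \<in> P \<Longrightarrow> r z (x - T x) = 0"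
  shows "z \<in> fixed_space"
proof -
  interpret s: contraction_pair r P T' T by (rule swap)
  have "z - T' z \<in> P" using s.diff_in assms(1) .
  then have "r (z - T' z) (z - T' z) = 0"
    using assms s.adjoint_diff by simp
  then have "z - T' z = 0" by (simp add: self)
  then show ?thesis using assms(1) fixed_space_swap s.fixed_space_def by auto
qed

lemma subspace_range: "subspace ((\<lambda>x. x - T x) ` P)"
  unfolding subspace_def
proof (intro conjI ballI allI)
  have "T 0 = 0" using T_scaleR[of 0 0] subspace_P subspace_0 by force
  then show "0 \<in> (\<lambda>x. x - T x) ` P" using subspace_P subspace_0 by (intro image_eqI[of _ _ 0]) auto
next
  fix a b assume "a \<in> (\<lambda>x. x - T x) ` P" "b \<in> (\<lambda>x. x - T x) ` P"
  then obtain x y where "x \<in> P" "y \<in> P" "a = x - T x" "b = y - T y" by blast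
  then show "a + b \<in> (\<lambda>x. x - T x) ` P"
    using subspace_P by (intro image_eqI[of _ _ "x + y"]) (auto simp: T_add subspace_add)
next
  fix c a assume "a \<in> (\<lambda>x. x - T x) ` P"
  then obtain x where "x \<in> P" "a = x - T x" by blast
  then show "c *\<^sub>R a \<in> (\<lambda>x. x - T x) ` P"
    using subspace_P by (intro image_eqI[of _ _ "c *\<^sub>R x"])
      (auto simp: T_scaleR subspace_scale scaleR_right_diff_distrib)
qed

text \<open>Project a vector of \<open>fixed_perp\<close> onto the closed range. The remainder is
  orthogonal to the range, hence fixed, and it still lies in \<open>fixed_perp\<close>, hence is
  zero.\<close>

lemma closed_range_eq:
  assumes "closed ((\<lambda>x. x - T x) ` P)"
  shows "(\<lambda>x. x - T x) ` P = fixed_perp"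
proof
  show "(\<lambda>x. x - T x) ` P \<subseteq> fixed_perp" using range_subset by blast
  show "fixed_perp \<subseteq> (\<lambda>x. x - T x) ` P"
  proof
    fix z assume z: "z \<in> fixed_perp"
    obtain m where m: "m \<in> (\<lambda>x. x - T x) ` P"
      "\<And>y. y \<in> (\<lambda>x. x - T x) ` P \<Longrightarrow> r (z - m) y = 0"
      using projection[OF assms subspace_range] by blast
    have mM: "m \<in> fixed_perp" using m(1) range_subset by blast
    have zm: "z - m \<in> fixed_perp" using z mM subspace_fixed_perp subspace_diff by blast
    have "z - m \<in> fixed_space" using zm m(2) by (intro perp_range) (auto simp: fixed_perp_def)
    then show "z \<in> (\<lambda>x. x - T x) ` P" using fixed_perp_fixed_space[OF zm] m(1) by simp
  qed
qed

text \<open>The error of the projection onto \<open>fixed_perp\<close> is orthogonal to the range of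
  1 - T, which lies in \<open>fixed_perp\<close>, so \<open>perp_range\<close> makes it
  fixed.\<close>

lemma decompose:
  assumes "x \<in> P"
  obtains m where "m \<in> fixed_perp" "x - m \<in> fixed_space"
proof -
  obtain m where m: "m \<in> fixed_perp" "\<And>y. y \<in> fixed_perp \<Longrightarrow> r (x - m) y = 0"
    using projection[OF closed_fixed_perp subspace_fixed_perp] by blast
  have "x - m \<in> P" using m(1) assms subspace_P subspace_diff by (auto simp: fixed_perp_def)
  then have "x - m \<in> fixed_space" using m(2) range_subset by (intro perp_range) auto
  then show ?thesis using m(1) that by blast
qed

lemma range_restrict_fixed_perp: "x \<in> P \<Longrightarrow> \<exists>m\<in>fixed_perp. x - T x = m - T m"
proof -
  assume x: "x \<in> P"
  obtain m where m: "m \<in> fixed_perp" "x - m \<in> fixed_space" using decompose[OF x] .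
  then have "T x - T m = x - m" using x by (auto simp: fixed_space_def fixed_perp_def T_diff)
  then show ?thesis using m(1) by (intro bexI[of _ m]) (simp_all add: algebra_simps)
qed

text \<open>Writing z = x - T x gives \<open>r z y = r x (y - T' y)\<close>, so the vectors
  \<open>y\<close> with \<open>norm (y - T' y) \<le> 1\<close> are pointwise bounded on
  \<open>fixed_perp\<close>. Uniform boundedness then plays the part of the open mapping theorem,
  and scaling gives the estimate.\<close>

lemma adjoint_bounded_below:
  assumes "fixed_perp \<subseteq> (\<lambda>x. x - T x) ` P"
  obtains K where "\<And>y. y \<in> fixed_perp \<Longrightarrow> norm y \<le> K * norm (y - T' y)"
proof -
  let ?Y = "{y \<in> fixed_perp. norm (y - T' y) \<le> 1}"
  have "\<exists>C. \<forall>y\<in>?Y. \<bar>r z y\<bar> \<le> C" if z: "z \<in> fixed_perp" for z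
  proof -
    obtain x where x: "x \<in> P" "z = x - T x" using assms z by blast
    have "\<bar>r z y\<bar> \<le> norm x" if "y \<in> ?Y" for y
    proof -
      have "r z y = r x (y - T' y)" using x that by (simp add: adjoint_diff fixed_perp_def)
      then have "\<bar>r z y\<bar> \<le> norm x * norm (y - T' y)" using cauchy_schwarz by simp
      also have "\<dots> \<le> norm x * 1" using that by (intro mult_left_mono) auto
      finally show ?thesis by simp
    qed
    then show ?thesis by blast
  qed
  then obtain K where K: "\<And>y. y \<in> ?Y \<Longrightarrow> norm y \<le> K"
    using uniform_boundedness[OF closed_fixed_perp subspace_fixed_perp, of ?Y] by blast
  interpret s: contraction_pair r P T' T by (rule swap)
  have "norm y \<le> K * norm (y - T' y)" if y: "y \<in> fixed_perp" for y
  proof (cases "y - T' y = 0")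
    case True
    then have "y \<in> fixed_space" using y fixed_space_swap by (auto simp: s.fixed_space_def fixed_perp_def)
    then have "y = 0" using fixed_perp_fixed_space y by blast
    then show ?thesis using True by simp
  next
    case False
    define c where "c = 1 / norm (y - T' y)"
    have "c *\<^sub>R y - T' (c *\<^sub>R y) = c *\<^sub>R (y - T' y)"
      using y by (simp add: T'_scaleR fixed_perp_def scaleR_right_diff_distrib)
    then have "norm (c *\<^sub>R y - T' (c *\<^sub>R y)) \<le> 1" using False by (simp add: c_def)
    then have "norm (c *\<^sub>R y) \<le> K" using y subspace_fixed_perp by (intro K) (auto intro: subspace_scale)
    then show ?thesis using False by (simp add: c_def field_simps)
  qed
  then show ?thesis using that by blast
qed

text \<open>Preimages can be chosen in \<open>fixed_perp\<close>, where the estimate makes them a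
  Cauchy sequence; its limit is a preimage of the limit because the contraction \<open>T\<close> is
  continuous.\<close>

lemma closed_range_if_bounded_below:
  assumes K: "\<And>y. y \<in> fixed_perp \<Longrightarrow> norm y \<le> K * norm (y - T y)"
  shows "closed ((\<lambda>x. x - T x) ` P)"
proof (unfold closed_sequential_limits, intro allI impI, elim conjE)
  fix f l assume f: "\<forall>n. f n \<in> (\<lambda>x. x - T x) ` P" and l: "f \<longlonglongrightarrow> l"
  have "\<exists>m\<in>fixed_perp. f n = m - T m" for n using f range_restrict_fixed_perp by (metis imageE)
  then obtain g where g: "\<And>n. g n \<in> fixed_perp" "\<And>n. f n = g n - T (g n)" by metis
  have gP: "g n \<in> P" for n using g(1) by (simp add: fixed_perp_def)
  \<comment> \<open>\<open>K\<close> comes with no sign, hence the absolute value here and the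
    \<open>+ 1\<close> in the divisor below.\<close>
  have le: "norm (g m - g n) \<le> \<bar>K\<bar> * norm (f m - f n)" for m n
  proof -
    have "norm (g m - g n) \<le> K * norm ((g m - g n) - T (g m - g n))"
      using g(1) subspace_fixed_perp by (intro K) (auto intro: subspace_diff)
    also have "(g m - g n) - T (g m - g n) = f m - f n"
      using g(2) gP by (simp add: T_diff)
    also have "K * norm (f m - f n) \<le> \<bar>K\<bar> * norm (f m - f n)" by (intro mult_right_mono) auto
    finally show ?thesis .
  qed
  have "Cauchy g"
  proof (rule CauchyI)
    fix e :: real assume "0 < e"
    then have "0 < e / (\<bar>K\<bar> + 1)" by simp
    then obtain N where N: "\<And>m n. m \<ge> N \<Longrightarrow> n \<ge> N \<Longrightarrow> norm (f m - f n) < e / (\<bar>K\<bar> + 1)"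
      using CauchyD[OF LIMSEQ_imp_Cauchy[OF l]] by metis
    have "norm (g m - g n) < e" if "m \<ge> N" "n \<ge> N" for m n
    proof -
      have "norm (g m - g n) \<le> (\<bar>K\<bar> + 1) * norm (f m - f n)"
        by (rule order_trans[OF le]) (auto intro: mult_right_mono)
      also have "\<dots> < e" using N[OF that] by (simp add: pos_less_divide_eq mult.commute)
      finally show ?thesis .
    qed
    then show "\<exists>N. \<forall>m\<ge>N. \<forall>n\<ge>N. norm (g m - g n) < e" by blast
  qed
  then obtain h where h: "g \<longlonglongrightarrow> h" using Cauchy_convergent convergent_def by blast
  have hP: "h \<in> P" using closed_P gP h closed_sequentially by blast
  have "(\<lambda>n. T (g n) - T h) \<longlonglongrightarrow> 0"
  proof (rule Lim_null_comparison)
    show "\<forall>\<^sub>F n in sequentially. norm (T (g n) - T h) \<le> norm (g n - h)"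
      using T_norm[of "g _ - h"] gP hP subspace_P by (auto simp: T_diff subspace_diff)
    show "(\<lambda>n. norm (g n - h)) \<longlonglongrightarrow> 0"
      using h LIM_zero_iff tendsto_norm_zero by blast
  qed
  then have "(\<lambda>n. T (g n)) \<longlonglongrightarrow> T h" by (rule LIM_zero_cancel)
  then have "(\<lambda>n. g n - T (g n)) \<longlonglongrightarrow> h - T h" by (intro tendsto_diff h)
  then have "l = h - T h" using l g(2) LIMSEQ_unique by (metis (no_types, lifting) ext)
  then show "l \<in> (\<lambda>x. x - T x) ` P" using hP by blast
qed

text \<open>If 1 - T maps onto \<open>fixed_perp\<close>, then 1 - T' is bounded below on that same
  space, which forces its range to be closed.\<close>

lemma closed_range_adjoint:
  assumes "closed ((\<lambda>x. x - T x) ` P)"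
  shows "closed ((\<lambda>x. x - T' x) ` P)"
proof -
  interpret s: contraction_pair r P T' T by (rule swap)
  show ?thesis
    using adjoint_bounded_below closed_range_eq[OF assms] s.closed_range_if_bounded_below fixed_perp_swap
    by (metis order_refl)
qed

text \<open>The lower bound for an adjoint, applied to \<open>T'\<close> in the role of
  \<open>T\<close>. It provides the boundedness of the generalized inverse.\<close>

lemma bounded_below:
  assumes "closed ((\<lambda>x. x - T x) ` P)"
  obtains K where "\<And>x. x \<in> fixed_perp \<Longrightarrow> norm x \<le> K * norm (x - T x)"
proof -
  interpret s: contraction_pair r P T' T by (rule swap)
  show ?thesis
    using s.adjoint_bounded_below s.closed_range_eq[OF closed_range_adjoint[OF assms]] fixed_perp_swap that
    by (metis order_refl)
qed

end

section \<open>Generalized inverses\<close>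

lemma mult_conj_of_real: "x * conj x = of_real ((norm (x::'a::real_or_complex))\<^sup>2)"
  by (simp add: mult_conj scaleR_conv_of_real del: of_real_power)

lemma conj_zero [simp]: "conj (0::'a::real_or_complex) = 0"
  using conj_add[of 0 "0::'a"] by simp

text \<open>The product \<open>x * conj x\<close> determines \<open>conj x\<close> for nonzero
  \<open>x\<close>, so multiplicativity is inherited from the norm.\<close>

lemma conj_mult: "conj (x * y) = conj x * conj (y::'a::real_or_complex)"
proof (cases "x * y = 0")
  case False
  have "(x * y) * conj (x * y) = (x * conj x) * (y * conj y)"
    unfolding mult_conj_of_real by (simp add: norm_mult power_mult_distrib)
  also have "\<dots> = (x * y) * (conj x * conj y)" by (simp add: ac_simps)
  finally show ?thesis using False by simp
qed auto

lemma conj_of_real [simp]: "conj (of_real s :: 'a::real_or_complex) = of_real s"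
proof (cases "s = 0")
  case False
  have "(of_real s :: 'a) * conj (of_real s) = of_real s * of_real s"
    unfolding mult_conj_of_real by (simp add: power2_eq_square)
  then show ?thesis using False by simp
qed simp

text \<open>
  The real part of the inner product, expressed by the norm alone: this reduces the analysis to
  real scalars.
\<close>

definition polar :: "'v::real_normed_vector \<Rightarrow> 'v \<Rightarrow> real" where
  "polar x y = ((norm (x + y))\<^sup>2 - (norm (x - y))\<^sup>2) / 4"

context hilbert_space
begin

lemma inner_prod_add_right: "inner_prod z (x + y) = inner_prod z x + inner_prod z y"
  by (metis inner_prod_commute inner_prod_add_left conj_add)

lemma inner_prod_scale_right: "inner_prod x (scale c y) = conj c * inner_prod x y"
  by (metis inner_prod_commute inner_prod_scale_left conj_mult)

lemma inner_prod_minus_left: "inner_prod (- x) y = - inner_prod x y"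
  using inner_prod_scale_left[of "-1" x y] by simp

lemma inner_prod_minus_right: "inner_prod x (- y) = - inner_prod x y"
  using inner_prod_commute conj_add[of "inner_prod y x" "- inner_prod y x"]
  by (metis add.inverse_unique add.right_inverse conj_zero inner_prod_minus_left)

lemma inner_prod_diff_left: "inner_prod (x - y) z = inner_prod x z - inner_prod y z"
  using inner_prod_add_left[of x "- y" z] by (simp add: inner_prod_minus_left)

lemma inner_prod_diff_right: "inner_prod z (x - y) = inner_prod z x - inner_prod z y"
  using inner_prod_add_right[of z x "- y"] by (simp add: inner_prod_minus_right)

lemma inner_prod_zero_left [simp]: "inner_prod 0 x = 0"
  using inner_prod_diff_left[of 0 0 x] by simp

lemma inner_prod_zero_right [simp]: "inner_prod x 0 = 0"
  using inner_prod_diff_right[of x 0 0] by simp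

lemma inner_prod_self_eq_0: "inner_prod x x = 0 \<longleftrightarrow> x = 0"
  by (simp add: inner_prod_self)

lemma of_real_polar: "of_real (polar x y) = (inner_prod x y + inner_prod y x) / 2"
proof -
  have "(of_real ((norm (x + y))\<^sup>2 - (norm (x - y))\<^sup>2) :: 'k)
      = 2 * inner_prod x y + 2 * inner_prod y x"
    unfolding of_real_diff inner_prod_self[symmetric]
    by (simp add: inner_prod_add_left inner_prod_add_right inner_prod_diff_left inner_prod_diff_right)
  then show ?thesis by (simp add: polar_def field_simps)
qed

text \<open>Each identity is checked in \<open>'k\<close> through \<open>of_real_polar\<close> and
  pulled back along the injective \<open>of_real\<close>.\<close>

lemma real_inner_form_polar: "real_inner_form (polar :: 'v \<Rightarrow> _)"
proof
  fix x y z :: 'v and c :: real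
  have "(of_real (polar (x + y) z) :: 'k) = of_real (polar x z + polar y z)"
    unfolding of_real_add of_real_polar
    by (simp add: inner_prod_add_left inner_prod_add_right field_simps)
  then show "polar (x + y) z = polar x z + polar y z" by (simp only: of_real_eq_iff)
  have "(of_real (polar (c *\<^sub>R x) y) :: 'k) = of_real (c * polar x y)"
    unfolding of_real_mult of_real_polar scale_of_real[symmetric]
    by (simp add: inner_prod_scale_left inner_prod_scale_right field_simps)
  then show "polar (c *\<^sub>R x) y = c * polar x y" by (simp only: of_real_eq_iff)
  show "polar x y = polar y x" by (simp add: polar_def add.commute norm_minus_commute)
  show "polar x x = (norm x)\<^sup>2" by (simp add: polar_def power_mult_distrib flip: scaleR_2)
qed

lemma polar_eq_0: "inner_prod x y = 0 \<Longrightarrow> polar x y = 0"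
  using of_real_polar[of x y] inner_prod_commute[of y x] by simp

lemma inner_prod_eq_polar_eq:
  "inner_prod x y = inner_prod x' y' \<Longrightarrow> polar x y = polar x' y'"
  using of_real_polar[of x y] of_real_polar[of x' y']
    inner_prod_commute[of y x] inner_prod_commute[of y' x']
  by (metis of_real_eq_iff)

text \<open>Since \<open>S\<close> is closed under scalars, \<open>y\<close> may be multiplied by
  \<open>inner_prod x y\<close>. This turns the inner product into its squared modulus, which the
  real part detects.\<close>

lemma orthogonal_iff_polar:
  assumes "local.subspace S"
  shows "(\<forall>y\<in>S. inner_prod x y = 0) \<longleftrightarrow> (\<forall>y\<in>S. polar x y = 0)"
proof
  assume *: "\<forall>y\<in>S. polar x y = 0"
  show "\<forall>y\<in>S. inner_prod x y = 0"
  proof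
    fix y assume "y \<in> S"
    define c where "c = inner_prod x y"
    define s where "s = (norm (inner_prod y x))\<^sup>2"
    have 1: "inner_prod (scale c y) x = of_real s"
      using mult_conj_of_real[of "inner_prod y x"]
      by (simp add: inner_prod_scale_left c_def s_def inner_prod_commute[of x y] mult.commute)
    then have 2: "inner_prod x (scale c y) = of_real s"
      using inner_prod_commute[of x "scale c y"] by simp
    have "polar x (scale c y) = 0"
      using * assms \<open>y \<in> S\<close> subspace_scale by blast
    then have "s = 0" using of_real_polar[of x "scale c y"] 1 2 by simp
    then show "inner_prod x y = 0" using inner_prod_commute[of x y] by (simp add: s_def)
  qed
qed (use polar_eq_0 in blast)

lemma real_subspace: "local.subspace S \<Longrightarrow> real_vector.subspace S"
  unfolding local.subspace_def real_vector.subspace_def by (metis scale_of_real)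

end

text \<open>\<open>X y\<close> is the unique vector of \<open>fixed_perp\<close> that 1 - T sends to
  the projection of \<open>y\<close> onto the range; the latter is expressed by the error lying in
  \<open>fixed_space\<close>. Uniqueness yields linearity, and \<open>bounded_below\<close> yields
  the norm bound.\<close>

lemma generalized_inverse_exists:
  fixes V :: "('k::real_or_complex, 'v::banach) super_space"
  assumes "hilbert_space (smul V) (ip V)" "module.subspace (smul V) P"
    and "contraction_pair polar P T T'"
    and T_scale: "\<And>c x. x \<in> P \<Longrightarrow> T (smul V c x) = smul V c (T x)"
    and cl: "closed ((\<lambda>x. x - T x) ` P)"
  shows "\<exists>X. generalized_inverse V P V P (\<lambda>x. x - T x) X"
proof -
  interpret hilbert_space "smul V" "ip V" by fact
  interpret C: contraction_pair polar P T T' by fact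
  note P = assms(2)
  have Fs: "subspace C.fixed_space"
    using P T_scale C.T_add C.T_scaleR[of 0 0] by (auto simp: subspace_def C.fixed_space_def)
  have F_ker: "C.fixed_space = {x \<in> P. x - T x = 0}"
    unfolding C.fixed_space_def right_minus_eq by metis
  \<comment> \<open>\<open>fixed_perp\<close> is formed with the real form; as the kernel is a
    subspace over \<open>'k\<close>, it is also the complement with respect to
    \<open>ip V\<close>.\<close>
  have M_eq: "C.fixed_perp = orth_in V P {x \<in> P. x - T x = 0}"
    unfolding orth_in_def C.fixed_perp_def F_ker[symmetric] using orthogonal_iff_polar[OF Fs] by blast
  have Ms: "subspace C.fixed_perp"
    unfolding M_eq using P
    by (auto simp: subspace_def orth_in_def inner_prod_add_left inner_prod_scale_left)
  have ran: "(\<lambda>x. x - T x) ` P = C.fixed_perp" by (rule C.closed_range_eq[OF cl])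
  have ex: "\<exists>x\<in>C.fixed_perp. y - (x - T x) \<in> C.fixed_space" if y: "y \<in> P" for y
  proof -
    obtain m where m: "m \<in> C.fixed_perp" "y - m \<in> C.fixed_space" using C.decompose[OF y] .
    then obtain x where "x \<in> P" "m = x - T x" using ran by blast
    then show ?thesis using C.range_restrict_fixed_perp[of x] m(2) by auto
  qed
  \<comment> \<open>The image of the difference under 1 - T is both fixed and orthogonal to fixed
    vectors, so it vanishes; then the same argument applies to the difference itself.\<close>
  have uniq: "x = x'" if "x \<in> C.fixed_perp" "x' \<in> C.fixed_perp"
    "y - (x - T x) \<in> C.fixed_space" "y - (x' - T x') \<in> C.fixed_space" for x x' y
  proof -
    have P': "x \<in> P" "x' \<in> P" using that by (auto simp: C.fixed_perp_def)
    let ?d = "x - x'"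
    have d: "?d \<in> C.fixed_perp" using that Ms subspace_diff by blast
    have "(y - (x' - T x')) - (y - (x - T x)) = ?d - T ?d" using P' by (simp add: C.T_diff)
    then have "?d - T ?d \<in> C.fixed_space" using that Fs subspace_diff by metis
    moreover have "?d - T ?d \<in> C.fixed_perp" using d C.range_subset by (simp add: C.fixed_perp_def)
    ultimately have "?d - T ?d = 0" using C.fixed_perp_fixed_space by blast
    then have "?d \<in> C.fixed_space" using d by (simp add: C.fixed_space_def C.fixed_perp_def)
    then show ?thesis using C.fixed_perp_fixed_space[OF d] by simp
  qed
  define X where "X y = (SOME x. x \<in> C.fixed_perp \<and> y - (x - T x) \<in> C.fixed_space)" for y
  have X: "X y \<in> C.fixed_perp" "y - (X y - T (X y)) \<in> C.fixed_space" if "y \<in> P" for y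
    using someI_ex[of "\<lambda>x. x \<in> C.fixed_perp \<and> y - (x - T x) \<in> C.fixed_space"] ex[OF that]
    by (auto simp: X_def)
  have X_eq: "X y = x" if "y \<in> P" "x \<in> C.fixed_perp" "y - (x - T x) \<in> C.fixed_space" for x y
    using uniq X that by blast
  have XP: "X y \<in> P" if "y \<in> P" for y using X[OF that] by (simp add: C.fixed_perp_def)
  have X_add: "X (y + z) = X y + X z" if "y \<in> P" "z \<in> P" for y z
  proof (rule X_eq)
    show "y + z \<in> P" "X y + X z \<in> C.fixed_perp" using that X P Ms subspace_add by blast+
    have "(y + z) - ((X y + X z) - T (X y + X z)) = (y - (X y - T (X y))) + (z - (X z - T (X z)))"
      using that by (simp add: C.T_add XP)
    then show "(y + z) - ((X y + X z) - T (X y + X z)) \<in> C.fixed_space"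
      using that X Fs subspace_add by metis
  qed
  have X_scale: "X (smul V c y) = smul V c (X y)" if "y \<in> P" for y c
  proof (rule X_eq)
    show "smul V c y \<in> P" "smul V c (X y) \<in> C.fixed_perp" using that X P Ms subspace_scale by blast+
    have "smul V c y - (smul V c (X y) - T (smul V c (X y))) = smul V c (y - (X y - T (X y)))"
      using that by (simp add: T_scale XP scale_right_diff_distrib)
    then show "smul V c y - (smul V c (X y) - T (smul V c (X y))) \<in> C.fixed_space"
      using that X Fs subspace_scale by metis
  qed
  obtain K where K: "\<And>x. x \<in> C.fixed_perp \<Longrightarrow> norm x \<le> K * norm (x - T x)"
    using C.bounded_below[OF cl] by blast
  have X_norm: "norm (X y) \<le> \<bar>K\<bar> * norm y" if "y \<in> P" for y
  proof -
    \<comment> \<open>\<open>?m\<close> is the component of \<open>y\<close> in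
      \<open>fixed_perp\<close>, so by Pythagoras its norm is at most that of
      \<open>y\<close>.\<close>
    let ?m = "X y - T (X y)"
    have "?m \<in> C.fixed_perp" using XP[OF that] C.range_subset by blast
    then have "polar ?m (y - ?m) = 0" using X(2)[OF that] by (simp add: C.fixed_perp_def)
    then have "(norm (?m + (y - ?m)))\<^sup>2 = (norm ?m)\<^sup>2 + (norm (y - ?m))\<^sup>2"
      unfolding C.norm_add_square by simp
    then have "(norm ?m)\<^sup>2 \<le> (norm y)\<^sup>2" by simp
    then have "norm ?m \<le> norm y" by (rule power2_le_imp_le) simp
    have "norm (X y) \<le> K * norm ?m" using K X(1)[OF that] .
    also have "\<dots> \<le> \<bar>K\<bar> * norm ?m" by (intro mult_right_mono) auto
    also have "\<dots> \<le> \<bar>K\<bar> * norm y" using \<open>norm ?m \<le> norm y\<close> by (intro mult_left_mono) auto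
    finally show ?thesis .
  qed
  have XA: "X (x - T x) = x" if "x \<in> C.fixed_perp" for x
    using that C.diff_in Fs subspace_0 by (intro X_eq) (auto simp: C.fixed_perp_def)
  have AX: "X y - T (X y) = y" if "y \<in> C.fixed_perp" for y
  proof -
    have y: "y \<in> P" using that by (simp add: C.fixed_perp_def)
    have "y - (X y - T (X y)) \<in> C.fixed_perp"
      using that C.range_subset[OF XP[OF y]] Ms subspace_diff by blast
    then show ?thesis using C.fixed_perp_fixed_space X(2)[OF y] by fastforce
  qed
  have T0: "T 0 = 0" using C.T_scaleR[of 0 0] P subspace_0 by force
  have kerX: "X y = 0 \<longleftrightarrow> y \<in> C.fixed_space" if "y \<in> P" for y
  proof
    assume "X y = 0"
    then show "y \<in> C.fixed_space" using X(2)[OF that] T0 by simp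
  next
    assume "y \<in> C.fixed_space"
    moreover have "0 \<in> C.fixed_perp" using Ms by (rule subspace_0)
    ultimately show "X y = 0" using X_eq[OF that, of 0] T0 by simp
  qed
  have F_eq: "C.fixed_space = orth_in V P C.fixed_perp"
  proof
    show "C.fixed_space \<subseteq> orth_in V P C.fixed_perp"
    proof
      fix k assume k: "k \<in> C.fixed_space"
      then have "\<forall>y\<in>C.fixed_perp. polar k y = 0" by (simp add: C.fixed_perp_def C.commute[of k])
      then show "k \<in> orth_in V P C.fixed_perp"
        using orthogonal_iff_polar[OF Ms] k by (simp add: orth_in_def C.fixed_space_def)
    qed
    show "orth_in V P C.fixed_perp \<subseteq> C.fixed_space"
    proof
      fix z assume z: "z \<in> orth_in V P C.fixed_perp"
      then have "\<forall>y\<in>C.fixed_perp. polar z y = 0" using orthogonal_iff_polar[OF Ms] by (simp add: orth_in_def)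
      then show "z \<in> C.fixed_space" using z C.range_subset by (intro C.perp_range) (auto simp: orth_in_def)
    qed
  qed
  have XI: "X ` P = C.fixed_perp"
  proof
    show "X ` P \<subseteq> C.fixed_perp" using X by blast
    show "C.fixed_perp \<subseteq> X ` P"
    proof
      fix x assume x: "x \<in> C.fixed_perp"
      then have "x - T x \<in> P" using C.diff_in by (simp add: C.fixed_perp_def)
      then show "x \<in> X ` P" using XA[OF x] by (metis imageI)
    qed
  qed
  have "C.fixed_perp \<subseteq> P" by (auto simp: C.fixed_perp_def)
  moreover have "\<exists>K. \<forall>y\<in>P. norm (X y) \<le> K * norm y" using X_norm by blast
  moreover have "{y \<in> P. X y = 0} = orth_in V P C.fixed_perp" using kerX F_eq by (auto simp: C.fixed_space_def)
  ultimately show ?thesis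
    unfolding generalized_inverse_def bounded_op_def linear_op_def ran M_eq[symmetric]
    by (intro exI[of _ X]) (use XP X_add X_scale XI XA AX in blast)
qed

section \<open>Unitaries and Lagrangians in super Hilbert spaces\<close>

lemma super_hilbertD:
  assumes "super_hilbert V"
  shows "hilbert_space (smul V) (ip V)"
    and "module.subspace (smul V) (pos V)" and "module.subspace (smul V) (neg V)"
    and "x \<in> pos V \<Longrightarrow> y \<in> neg V \<Longrightarrow> ip V x y = 0"
    and "\<exists>p\<in>pos V. \<exists>n\<in>neg V. z = p + n"
  using assms by (auto simp: super_hilbert_def)

lemma parity_simps [simp]:
  "smul (\<Pi> V) = smul V" "ip (\<Pi> V) = ip V" "pos (\<Pi> V) = neg V" "neg (\<Pi> V) = pos V"
  by (simp_all add: parity_def)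

lemma direct_sum_simps [simp]:
  "smul (V \<oplus> W) c (x, y) = (smul V c x, smul W c y)"
  "ip (V \<oplus> W) (x, y) (x', y') = ip V x x' + ip W y y'"
  "pos (V \<oplus> W) = pos V \<times> pos W" "neg (V \<oplus> W) = neg V \<times> neg W"
  by (simp_all add: direct_sum_def)

lemma linear_op_parity [simp]:
  "linear_op (\<Pi> V) S W T f = linear_op V S W T f" "linear_op V S (\<Pi> W) T f = linear_op V S W T f"
  by (simp_all add: linear_op_def)

lemma smul_parity_sum [simp]: "smul (V \<oplus> \<Pi> W) = smul (V \<oplus> W)" "smul (\<Pi> V \<oplus> W) = smul (V \<oplus> W)"
  by (simp_all add: direct_sum_def)

lemma ip_parity_sum [simp]: "ip (V \<oplus> \<Pi> W) = ip (V \<oplus> W)" "ip (\<Pi> V \<oplus> W) = ip (V \<oplus> W)"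
  by (simp_all add: direct_sum_def)

text \<open>If the limit has negative part \<open>q\<close>, then by Pythagoras every term of the
  sequence stays at distance at least \<open>norm q\<close> from it, so \<open>q\<close> is
  zero.\<close>

lemma closed_pos:
  assumes "super_hilbert V"
  shows "closed (pos V)"
proof (unfold closed_sequential_limits, intro allI impI, elim conjE)
  fix f l assume f: "\<forall>n. f n \<in> pos V" and l: "f \<longlonglongrightarrow> l"
  interpret hilbert_space "smul V" "ip V" using super_hilbertD[OF assms] by simp
  interpret real_inner_form "polar :: 'b \<Rightarrow> _" by (rule real_inner_form_polar)
  obtain p q where pq: "p \<in> pos V" "q \<in> neg V" "l = p + q"
    using super_hilbertD(5)[OF assms] by blast
  have le: "norm q \<le> norm (f n - l)" for n
  proof -
    have "p - f n \<in> pos V" using super_hilbertD(2)[OF assms] f pq(1) subspace_diff by blast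
    then have "polar (p - f n) q = 0" using super_hilbertD(4)[OF assms] pq(2) polar_eq_0 by blast
    then have "(norm ((p - f n) + q))\<^sup>2 = (norm (p - f n))\<^sup>2 + (norm q)\<^sup>2"
      unfolding norm_add_square by simp
    then have "(norm q)\<^sup>2 \<le> (norm ((p - f n) + q))\<^sup>2" by simp
    also have "norm ((p - f n) + q) = norm (f n - l)"
      by (simp add: pq(3) norm_minus_commute algebra_simps)
    finally show ?thesis by (rule power2_le_imp_le) simp
  qed
  have "(\<lambda>n. norm (f n - l)) \<longlonglongrightarrow> 0" using l LIM_zero tendsto_norm_zero by blast
  then have "norm q \<le> 0" using le by (intro LIMSEQ_le_const) auto
  then show "l \<in> pos V" using pq by simp
qed

lemma closed_neg: "super_hilbert V \<Longrightarrow> closed (neg V)"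
  using closed_pos[OF super_hilbert_parity, of V] by simp

section \<open>Inverses and graphs of unitaries\<close>

lemma unitary_op_inverse:
  assumes "hilbert_space (smul V) (ip V)" "hilbert_space (smul W) (ip W)"
    and S: "module.subspace (smul V) S" and f: "unitary_op V S W T f"
  shows "inj_on f S" "unitary_op W T V S (inv_into S f)"
proof -
  interpret V: hilbert_space "smul V" "ip V" by fact
  interpret W: hilbert_space "smul W" "ip W" by fact
  have fadd: "\<And>x y. x \<in> S \<Longrightarrow> y \<in> S \<Longrightarrow> f (x + y) = f x + f y"
    and fscale: "\<And>c x. x \<in> S \<Longrightarrow> f (smul V c x) = smul W c (f x)"
    and fS: "f ` S = T"
    and fip: "\<And>x y. x \<in> S \<Longrightarrow> y \<in> S \<Longrightarrow> ip W (f x) (f y) = ip V x y"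
    using f by (auto simp: unitary_op_def linear_op_def)
  show inj: "inj_on f S"
  proof (rule inj_onI)
    fix x y assume xy: "x \<in> S" "y \<in> S" "f x = f y"
    have "ip V (x - y) (x - y) = 0"
      using xy by (simp add: V.inner_prod_diff_left V.inner_prod_diff_right flip: fip)
    then show "x = y" by (simp add: V.inner_prod_self_eq_0)
  qed
  let ?g = "inv_into S f"
  have g: "?g y \<in> S" "f (?g y) = y" if "y \<in> T" for y
    using that fS by (auto intro: inv_into_into f_inv_into_f)
  have g_eq: "?g y = x" if "x \<in> S" "f x = y" for x y
    using that inj by auto
  have add: "?g (y + z) = ?g y + ?g z" if "y \<in> T" "z \<in> T" for y z
    using that by (intro g_eq) (simp_all add: fadd g V.subspace_add[OF S])
  have scale: "?g (smul W c y) = smul V c (?g y)" if "y \<in> T" for c y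
    using that by (intro g_eq) (simp_all add: fscale g V.subspace_scale[OF S])
  have "?g ` T = S"
    using g_eq fS g by (auto simp: image_iff)
  moreover have "ip V (?g y) (?g z) = ip W y z" if "y \<in> T" "z \<in> T" for y z
    using fip[of "?g y" "?g z"] that by (simp add: g)
  ultimately show "unitary_op W T V S ?g"
    using g add scale by (auto simp: unitary_op_def linear_op_def)
qed

text \<open>The inverse of a block unitary is again a block unitary with positive and negative parts
  exchanged. The doubled parity in the conclusion is the shape needed to instantiate
  \<open>composable_unitaries\<close> at the parity-reversed spaces.\<close>

lemma unitary_block_inverse:
  fixes V :: "('k::real_or_complex, 'v::banach) super_space"
    and W :: "('k, 'w::banach) super_space"
  assumes V: "super_hilbert V" and W: "super_hilbert W"
    and f: "unitary_op (\<Pi> V \<oplus> W) (neg V \<times> pos W) (\<Pi> V \<oplus> W) (pos V \<times> neg W) f"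
  obtains a b c d
  where "linear_op V (pos V) V (neg V) a" "linear_op W (neg W) V (neg V) b"
    "linear_op V (pos V) W (pos W) c" "linear_op W (neg W) W (pos W) d"
    "unitary_op (\<Pi> (\<Pi> V) \<oplus> \<Pi> W) (pos V \<times> neg W) (\<Pi> (\<Pi> V) \<oplus> \<Pi> W) (neg V \<times> pos W) (block a b c d)"
    "\<And>y. y \<in> pos V \<times> neg W \<Longrightarrow> f (block a b c d y) = y"
proof -
  let ?U = "\<Pi> V \<oplus> W" and ?S = "neg V \<times> pos W" and ?T = "pos V \<times> neg W"
  interpret V: hilbert_space "smul V" "ip V" using super_hilbertD[OF V] by simp
  interpret W: hilbert_space "smul W" "ip W" using super_hilbertD[OF W] by simp
  have U: "super_hilbert ?U" by (intro super_hilbert_direct_sum super_hilbert_parity V W)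
  have S: "module.subspace (smul ?U) ?S" using super_hilbertD(2)[OF U] by simp
  note inv = unitary_op_inverse[OF super_hilbertD(1)[OF U] super_hilbertD(1)[OF U] S f]
  define g where "g = inv_into ?S f"
  have g: "unitary_op ?U ?T ?U ?S g" using inv g_def by simp
  have gS: "g y \<in> ?S" if "y \<in> ?T" for y using g that by (auto simp: unitary_op_def)
  have gadd: "g (x + y) = g x + g y" if "x \<in> ?T" "y \<in> ?T" for x y
    using g that by (auto simp: unitary_op_def linear_op_def)
  have gscale: "g (smul ?U c x) = smul ?U c (g x)" if "x \<in> ?T" for c x
    using g that unfolding unitary_op_def linear_op_def by blast
  have fT: "f ` ?S = ?T" using f by (simp add: unitary_op_def)
  have z: "0 \<in> pos V" "0 \<in> neg W"
    using V.subspace_0 W.subspace_0 super_hilbertD(2)[OF V] super_hilbertD(3)[OF W] by auto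
  define a b c d where "a = (\<lambda>x. fst (g (x, 0)))" and "b = (\<lambda>y. fst (g (0, y)))"
    and "c = (\<lambda>x. snd (g (x, 0)))" and "d = (\<lambda>y. snd (g (0, y)))"
  have bl: "block a b c d y = g y" if yT: "y \<in> ?T" for y
  proof -
    obtain y1 y2 where y: "y = (y1, y2)" "y1 \<in> pos V" "y2 \<in> neg W" using yT by auto
    have "g ((y1, 0) + (0, y2)) = g (y1, 0) + g (0, y2)" using y z by (intro gadd) auto
    then show ?thesis
      unfolding y(1) by (simp add: block_def a_def b_def c_def d_def prod_eq_iff)
  qed
  have add0: "g (x + x', 0) = g (x, 0) + g (x', 0)" if "x \<in> pos V" "x' \<in> pos V" for x x'
    using gadd[of "(x, 0)" "(x', 0)"] that z by simp
  have add1: "g (0, y + y') = g (0, y) + g (0, y')" if "y \<in> neg W" "y' \<in> neg W" for y y'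
    using gadd[of "(0, y)" "(0, y')"] that z by simp
  have sc0: "g (smul V k x, 0) = (smul V k (fst (g (x, 0))), smul W k (snd (g (x, 0))))"
    if "x \<in> pos V" for k x
    using gscale[of "(x, 0)" k] that z by (cases "g (x, 0)") simp
  have sc1: "g (0, smul W k y) = (smul V k (fst (g (0, y))), smul W k (snd (g (0, y))))"
    if "y \<in> neg W" for k y
    using gscale[of "(0, y)" k] that z by (cases "g (0, y)") simp
  have in0: "fst (g (x, 0)) \<in> neg V" "snd (g (x, 0)) \<in> pos W" if "x \<in> pos V" for x
    using gS[of "(x, 0)"] that z by (auto simp: mem_Times_iff)
  have in1: "fst (g (0, y)) \<in> neg V" "snd (g (0, y)) \<in> pos W" if "y \<in> neg W" for y
    using gS[of "(0, y)"] that z by (auto simp: mem_Times_iff)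
  show thesis
  proof (rule that[of a b c d])
    show "linear_op V (pos V) V (neg V) a" "linear_op W (neg W) V (neg V) b"
      "linear_op V (pos V) W (pos W) c" "linear_op W (neg W) W (pos W) d"
      by (auto simp: linear_op_def a_def b_def c_def d_def add0 add1 sc0 sc1 in0 in1)
    have "unitary_op ?U ?T ?U ?S (block a b c d)"
    proof -
      have sub: "x + y \<in> ?T" "smul ?U k x \<in> ?T" if "x \<in> ?T" "y \<in> ?T" for x y k
        using that V.subspace_add[OF super_hilbertD(2)[OF V]] W.subspace_add[OF super_hilbertD(3)[OF W]]
          V.subspace_scale[OF super_hilbertD(2)[OF V]] W.subspace_scale[OF super_hilbertD(3)[OF W]]
        by (auto simp: direct_sum_def)
      have "block a b c d ` ?T = ?S"
        using g bl by (metis (no_types, lifting) image_cong unitary_op_def)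
      then show ?thesis
        using g sub unfolding unitary_op_def linear_op_def by (simp add: bl)
    qed
    then show "unitary_op (\<Pi> (\<Pi> V) \<oplus> \<Pi> W) ?T (\<Pi> (\<Pi> V) \<oplus> \<Pi> W) ?S (block a b c d)"
      by (simp add: unitary_op_def linear_op_def)
    show "f (block a b c d y) = y" if "y \<in> ?T" for y
      using that fT by (subst bl) (auto simp: g_def f_inv_into_f)
  qed
qed

text \<open>Isotropy holds because pairing \<open>p - f p\<close> with \<open>q + f q\<close> leaves
  the difference of \<open>ip V p q\<close> and \<open>ip V (f p) (f q)\<close>, which is zero for a
  unitary.\<close>

lemma lagrangian_graph:
  assumes V: "super_hilbert V" and f: "unitary_op V (pos V) V (neg V) f"
  shows "lagrangian V (graph V f)"
proof -
  interpret hilbert_space "smul V" "ip V" using super_hilbertD[OF V] by simp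
  note P = super_hilbertD(2)[OF V]
  have fadd: "\<And>x y. x \<in> pos V \<Longrightarrow> y \<in> pos V \<Longrightarrow> f (x + y) = f x + f y"
    and fscale: "\<And>c x. x \<in> pos V \<Longrightarrow> f (smul V c x) = smul V c (f x)"
    and fim: "f ` pos V = neg V"
    and fip: "\<And>x y. x \<in> pos V \<Longrightarrow> y \<in> pos V \<Longrightarrow> ip V (f x) (f y) = ip V x y"
    using f by (auto simp: unitary_op_def linear_op_def)
  have fN: "f x \<in> neg V" if "x \<in> pos V" for x using fim that by blast
  have gr: "grading V (x + f x) = x - f x" if "x \<in> pos V" for x
    using grading_eq[OF V that fN[OF that]] .
  have f0: "f 0 = 0" using fscale[of 0 0] subspace_0[OF P] by simp
  have "subspace (graph V f)"
    unfolding subspace_def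
  proof (intro conjI ballI allI)
    show "0 \<in> graph V f" using subspace_0[OF P] f0 by (force simp: graph_def)
  next
    fix x y assume "x \<in> graph V f" "y \<in> graph V f"
    then obtain p q where pq: "p \<in> pos V" "q \<in> pos V" "x = p + f p" "y = q + f q"
      by (auto simp: graph_def)
    then have "x + y = (p + q) + f (p + q)" by (simp add: fadd)
    then show "x + y \<in> graph V f" using subspace_add[OF P pq(1,2)] unfolding graph_def by blast
  next
    fix c x assume "x \<in> graph V f"
    then obtain p where p: "p \<in> pos V" "x = p + f p" by (auto simp: graph_def)
    then have "smul V c x = smul V c p + f (smul V c p)" by (simp add: fscale scale_right_distrib)
    then show "smul V c x \<in> graph V f" using subspace_scale[OF P p(1)] unfolding graph_def by blast
  qed
  moreover have "grading_form V x y = 0" if "x \<in> graph V f" "y \<in> graph V f" for x y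
  proof -
    obtain p q where pq: "p \<in> pos V" "q \<in> pos V" "x = p + f p" "y = q + f q"
      using \<open>x \<in> graph V f\<close> \<open>y \<in> graph V f\<close> by (auto simp: graph_def)
    have "ip V p (f q) = 0" "ip V (f p) q = 0"
      using super_hilbertD(4)[OF V] pq(1,2) fN inner_prod_commute[of "f p" q] by auto
    then show ?thesis
      using pq by (simp add: grading_form_def gr inner_prod_diff_left inner_prod_add_right fip)
  qed
  moreover have "\<exists>x y. z = x + grading V y \<and> x \<in> graph V f \<and> y \<in> graph V f" for z
  proof -
    obtain p n where pn: "p \<in> pos V" "n \<in> neg V" "z = p + n" using super_hilbertD(5)[OF V] by blast
    obtain q where q: "q \<in> pos V" "n = f q" using fim pn(2) by blast
    \<comment> \<open>With n = f q, the equation p + n = (s + f s) + (t - f t) amounts to s + t = p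
      and s - t = q.\<close>
    define s t where "s = smul V (of_real (1/2)) (p + q)" and "t = smul V (of_real (1/2)) (p - q)"
    have st: "s \<in> pos V" "t \<in> pos V"
      using pn(1) q(1) P by (auto simp: s_def t_def intro!: subspace_scale subspace_add subspace_diff)
    have "s + t = p"
      unfolding s_def t_def scale_of_real by (simp flip: scaleR_add_right add: scaleR_2[symmetric])
    moreover have "s = t + q"
      unfolding s_def t_def scale_of_real by (simp add: algebra_simps flip: scaleR_add_left)
    ultimately have "z = (s + f s) + (t - f t)"
      using pn(3) q st fadd[of t q] by (simp add: algebra_simps)
    then show ?thesis using st gr by (metis (mono_tags, lifting) graph_def mem_Collect_eq)
  qed
  ultimately show ?thesis unfolding lagrangian_def isotropic_def by blast
qed

section \<open>Composition of unitaries\<close>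

lemma graph_block_iff:
  "(x, y) \<in> graph (\<Pi> V \<oplus> W) (block a b c d) \<longleftrightarrow>
    (\<exists>s\<in>neg V. \<exists>t\<in>pos W. x = s + (a s + b t) \<and> y = t + (c s + d t))"
  by (simp add: graph_def block_def mem_Times_iff) blast

locale composable_unitaries =
  fixes V0 :: "('k::real_or_complex, 'a::banach) super_space"
    and V1 :: "('k, 'b::banach) super_space"
    and V2 :: "('k, 'c::banach) super_space"
    and u00 :: "'a \<Rightarrow> 'a" and u01 :: "'b \<Rightarrow> 'a" and u10 :: "'a \<Rightarrow> 'b" and u11 :: "'b \<Rightarrow> 'b"
    and v11 :: "'b \<Rightarrow> 'b" and v12 :: "'c \<Rightarrow> 'b" and v21 :: "'b \<Rightarrow> 'c" and v22 :: "'c \<Rightarrow> 'c"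
  assumes V0: "super_hilbert V0" and V1: "super_hilbert V1" and V2: "super_hilbert V2"
    and u00: "linear_op V0 (neg V0) V0 (pos V0) u00" and u01: "linear_op V1 (pos V1) V0 (pos V0) u01"
    and u10: "linear_op V0 (neg V0) V1 (neg V1) u10" and u11: "linear_op V1 (pos V1) V1 (neg V1) u11"
    and v11: "linear_op V1 (neg V1) V1 (pos V1) v11" and v12: "linear_op V2 (pos V2) V1 (pos V1) v12"
    and v21: "linear_op V1 (neg V1) V2 (neg V2) v21" and v22: "linear_op V2 (pos V2) V2 (neg V2) v22"
    and u: "unitary_op (\<Pi> V0 \<oplus> V1) (neg V0 \<times> pos V1) (\<Pi> V0 \<oplus> V1) (pos V0 \<times> neg V1)
           (block u00 u01 u10 u11)"
    and v: "unitary_op (\<Pi> V1 \<oplus> V2) (neg V1 \<times> pos V2) (\<Pi> V1 \<oplus> V2) (pos V1 \<times> neg V2)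
           (block v11 v12 v21 v22)"
begin

section \<open>Algebra of the blocks\<close>

sublocale H0: hilbert_space "smul V0" "ip V0" using super_hilbertD[OF V0] by simp
sublocale H1: hilbert_space "smul V1" "ip V1" using super_hilbertD[OF V1] by simp
sublocale H2: hilbert_space "smul V2" "ip V2" using super_hilbertD[OF V2] by simp

lemmas sub = super_hilbertD(2,3)[OF V0] super_hilbertD(2,3)[OF V1] super_hilbertD(2,3)[OF V2]

lemmas zero_in [simp] = sub(1,2)[THEN H0.subspace_0] sub(3,4)[THEN H1.subspace_0]
  sub(5,6)[THEN H2.subspace_0]

lemmas add_in = sub(1,2)[THEN H0.subspace_add] sub(3,4)[THEN H1.subspace_add]
  sub(5,6)[THEN H2.subspace_add]

lemmas scale_in = sub(1,2)[THEN H0.subspace_scale] sub(3,4)[THEN H1.subspace_scale]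
  sub(5,6)[THEN H2.subspace_scale]

lemmas diff_in = sub(1,2)[THEN H0.subspace_diff] sub(3,4)[THEN H1.subspace_diff]
  sub(5,6)[THEN H2.subspace_diff]

lemma blocks_in [simp]:
  "a \<in> neg V0 \<Longrightarrow> u00 a \<in> pos V0" "p \<in> pos V1 \<Longrightarrow> u01 p \<in> pos V0"
  "a \<in> neg V0 \<Longrightarrow> u10 a \<in> neg V1" "p \<in> pos V1 \<Longrightarrow> u11 p \<in> neg V1"
  "n \<in> neg V1 \<Longrightarrow> v11 n \<in> pos V1" "c \<in> pos V2 \<Longrightarrow> v12 c \<in> pos V1"
  "n \<in> neg V1 \<Longrightarrow> v21 n \<in> neg V2" "c \<in> pos V2 \<Longrightarrow> v22 c \<in> neg V2"
  using u00 u01 u10 u11 v11 v12 v21 v22 by (auto simp: linear_op_def)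

lemma blocks_add:
  "a \<in> neg V0 \<Longrightarrow> a' \<in> neg V0 \<Longrightarrow> u00 (a + a') = u00 a + u00 a'"
  "p \<in> pos V1 \<Longrightarrow> p' \<in> pos V1 \<Longrightarrow> u01 (p + p') = u01 p + u01 p'"
  "a \<in> neg V0 \<Longrightarrow> a' \<in> neg V0 \<Longrightarrow> u10 (a + a') = u10 a + u10 a'"
  "p \<in> pos V1 \<Longrightarrow> p' \<in> pos V1 \<Longrightarrow> u11 (p + p') = u11 p + u11 p'"
  "n \<in> neg V1 \<Longrightarrow> n' \<in> neg V1 \<Longrightarrow> v11 (n + n') = v11 n + v11 n'"
  "c \<in> pos V2 \<Longrightarrow> c' \<in> pos V2 \<Longrightarrow> v12 (c + c') = v12 c + v12 c'"
  "n \<in> neg V1 \<Longrightarrow> n' \<in> neg V1 \<Longrightarrow> v21 (n + n') = v21 n + v21 n'"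
  "c \<in> pos V2 \<Longrightarrow> c' \<in> pos V2 \<Longrightarrow> v22 (c + c') = v22 c + v22 c'"
  using u00 u01 u10 u11 v11 v12 v21 v22 by (simp_all add: linear_op_def)

lemma blocks_scale:
  "a \<in> neg V0 \<Longrightarrow> u00 (smul V0 k a) = smul V0 k (u00 a)"
  "p \<in> pos V1 \<Longrightarrow> u01 (smul V1 k p) = smul V0 k (u01 p)"
  "a \<in> neg V0 \<Longrightarrow> u10 (smul V0 k a) = smul V1 k (u10 a)"
  "p \<in> pos V1 \<Longrightarrow> u11 (smul V1 k p) = smul V1 k (u11 p)"
  "n \<in> neg V1 \<Longrightarrow> v11 (smul V1 k n) = smul V1 k (v11 n)"
  "c \<in> pos V2 \<Longrightarrow> v12 (smul V2 k c) = smul V1 k (v12 c)"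
  "n \<in> neg V1 \<Longrightarrow> v21 (smul V1 k n) = smul V2 k (v21 n)"
  "c \<in> pos V2 \<Longrightarrow> v22 (smul V2 k c) = smul V2 k (v22 c)"
  using u00 u01 u10 u11 v11 v12 v21 v22 by (simp_all add: linear_op_def)

lemma blocks_zero [simp]:
  "u00 0 = 0" "u01 0 = 0" "u10 0 = 0" "u11 0 = 0" "v11 0 = 0" "v12 0 = 0" "v21 0 = 0" "v22 0 = 0"
  using blocks_add(1)[of 0 0] blocks_add(2)[of 0 0] blocks_add(3)[of 0 0] blocks_add(4)[of 0 0]
    blocks_add(5)[of 0 0] blocks_add(6)[of 0 0] blocks_add(7)[of 0 0] blocks_add(8)[of 0 0]
  by simp_all

lemma blocks_diff:
  assumes "p \<in> pos V1" "p' \<in> pos V1"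
  shows "u01 (p - p') = u01 p - u01 p'" "u11 (p - p') = u11 p - u11 p'"
  using assms blocks_add(2,4)[of "p - p'" p'] diff_in by auto

lemma blocks_diff':
  assumes "n \<in> neg V1" "n' \<in> neg V1"
  shows "v21 (n - n') = v21 n - v21 n'" "v11 (n - n') = v11 n - v11 n'"
  using assms blocks_add(7,5)[of "n - n'" n'] diff_in by auto

lemma u_ip:
  assumes "a \<in> neg V0" "p \<in> pos V1" "b \<in> neg V0" "q \<in> pos V1"
  shows "ip V0 (u00 a + u01 p) (u00 b + u01 q) + ip V1 (u10 a + u11 p) (u10 b + u11 q)
    = ip V0 a b + ip V1 p q"
proof -
  have "ip (\<Pi> V0 \<oplus> V1) (block u00 u01 u10 u11 x) (block u00 u01 u10 u11 y) = ip (\<Pi> V0 \<oplus> V1) x y"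
    if "x \<in> neg V0 \<times> pos V1" "y \<in> neg V0 \<times> pos V1" for x y
    using u that unfolding unitary_op_def by blast
  from this[of "(a, p)" "(b, q)"] show ?thesis using assms by (simp add: block_def direct_sum_def)
qed

lemma v_ip:
  assumes "n \<in> neg V1" "c \<in> pos V2" "m \<in> neg V1" "d \<in> pos V2"
  shows "ip V1 (v11 n + v12 c) (v11 m + v12 d) + ip V2 (v21 n + v22 c) (v21 m + v22 d)
    = ip V1 n m + ip V2 c d"
proof -
  have "ip (\<Pi> V1 \<oplus> V2) (block v11 v12 v21 v22 x) (block v11 v12 v21 v22 y) = ip (\<Pi> V1 \<oplus> V2) x y"
    if "x \<in> neg V1 \<times> pos V2" "y \<in> neg V1 \<times> pos V2" for x y
    using v that unfolding unitary_op_def by blast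
  from this[of "(n, c)" "(m, d)"] show ?thesis using assms by (simp add: block_def direct_sum_def)
qed

section \<open>Norm loss and fixed vectors\<close>

lemma u_norm: "p \<in> pos V1 \<Longrightarrow> (norm (u01 p))\<^sup>2 + (norm (u11 p))\<^sup>2 = (norm p)\<^sup>2"
  using u_ip[of 0 p 0 p]
  by (simp del: of_real_power add: H0.inner_prod_self H1.inner_prod_self flip: of_real_add)

lemma v_norm: "n \<in> neg V1 \<Longrightarrow> (norm (v11 n))\<^sup>2 + (norm (v21 n))\<^sup>2 = (norm n)\<^sup>2"
  using v_ip[of n 0 n 0]
  by (simp del: of_real_power add: H1.inner_prod_self H2.inner_prod_self flip: of_real_add)

lemma u11_norm: "p \<in> pos V1 \<Longrightarrow> norm (u11 p) \<le> norm p"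
  by (rule power2_le_imp_le) (use u_norm[of p] zero_le_power2[of "norm (u01 p)"] in linarith, simp)

lemma v11_norm: "n \<in> neg V1 \<Longrightarrow> norm (v11 n) \<le> norm n"
  by (rule power2_le_imp_le) (use v_norm[of n] zero_le_power2[of "norm (v21 n)"] in linarith, simp)

text \<open>The squared norms lost to \<open>u01\<close> and \<open>v21\<close> on the way from
  \<open>p\<close> back to \<open>p\<close> add up to zero.\<close>

lemma fixed_pos:
  assumes "p \<in> pos V1" "v11 (u11 p) = p"
  shows "u01 p = 0" "v21 (u11 p) = 0"
proof -
  have "(norm p)\<^sup>2 + (norm (v21 (u11 p)))\<^sup>2 = (norm (u11 p))\<^sup>2"
    using v_norm[of "u11 p"] assms by simp
  then have "(norm (u01 p))\<^sup>2 + (norm (v21 (u11 p)))\<^sup>2 = 0"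
    using u_norm[OF assms(1)] by linarith
  then show "u01 p = 0" "v21 (u11 p) = 0" by (auto simp: sum_power2_eq_zero_iff)
qed

text \<open>If \<open>n\<close> is fixed by the product in the other order, then
  \<open>v11 n\<close> is a fixed vector on the positive side and \<open>u11\<close> returns it to
  \<open>n\<close>.\<close>

lemma fixed_neg:
  assumes "n \<in> neg V1" "u11 (v11 n) = n"
  shows "v21 n = 0"
  using fixed_pos(2)[of "v11 n"] assms by simp

text \<open>
  If \<open>p = v11 n\<close> with \<open>n = u11 p\<close>, then \<open>u\<close> maps \<open>(0, p)\<close> to \<open>(0, n)\<close> and \<open>v\<close> maps \<open>(n, 0)\<close>
  to \<open>(p, 0)\<close>; orthogonality is preserved along both steps.
\<close>

lemma orthogonal_fixed:
  assumes "a \<in> neg V0" "c \<in> pos V2" "p \<in> pos V1" "v11 (u11 p) = p"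
  shows "ip V1 (v11 (u10 a) + v12 c) p = 0"
proof -
  have "ip V1 (u10 a) (u11 p) = 0"
    using u_ip[of a 0 0 p] fixed_pos[OF assms(3,4)] assms by simp
  then show ?thesis
    using v_ip[of "u10 a" c "u11 p" 0] fixed_pos[OF assms(3,4)] assms by simp
qed

text \<open>A middle vector \<open>p + n\<close> joining the point of the first graph with input
  \<open>(a, p)\<close> to the point of the second with input \<open>(n, c)\<close>. The input of
  the composite is \<open>(a, c)\<close>.\<close>

definition linked :: "'a \<Rightarrow> 'c \<Rightarrow> 'b \<Rightarrow> 'b \<Rightarrow> bool" where
  "linked a c p n \<longleftrightarrow> a \<in> neg V0 \<and> c \<in> pos V2 \<and> p \<in> pos V1 \<and> n \<in> neg V1 \<and>
     n = u10 a + u11 p \<and> p = v11 n + v12 c"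

text \<open>Eliminating \<open>n\<close> or \<open>p\<close> from the two defining equations gives
  the systems solved by \<open>X\<close> and by \<open>Y\<close> respectively.\<close>

lemma linked_equations:
  assumes "linked a c p n"
  shows "p - v11 (u11 p) = v11 (u10 a) + v12 c" "n - u11 (v11 n) = u10 a + u11 (v12 c)"
proof -
  have *: "a \<in> neg V0" "c \<in> pos V2" "p \<in> pos V1" "n \<in> neg V1"
    "n = u10 a + u11 p" "p = v11 n + v12 c"
    using assms unfolding linked_def by blast+
  have "v11 n = v11 (u10 a) + v11 (u11 p)" using * blocks_add(5) by (metis blocks_in(3,4))
  then show "p - v11 (u11 p) = v11 (u10 a) + v12 c" using *(6) by (simp add: algebra_simps)
  have "u11 p = u11 (v11 n) + u11 (v12 c)" using * blocks_add(4) by (metis blocks_in(5,6))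
  then show "n - u11 (v11 n) = u10 a + u11 (v12 c)" using *(5) by (simp add: algebra_simps)
qed

lemma linkedI:
  assumes "a \<in> neg V0" "c \<in> pos V2" "p \<in> pos V1" "p - v11 (u11 p) = v11 (u10 a) + v12 c"
  shows "linked a c p (u10 a + u11 p)"
  using assms unfolding linked_def by (auto simp: blocks_add add_in algebra_simps)

text \<open>Add the isometry identities of \<open>u\<close> and \<open>v\<close>: the terms in
  \<open>V1\<close> occur on both sides and cancel.\<close>

lemma linked_ip:
  assumes "linked a c p n" "linked b d q m"
  shows "ip V0 (u00 a + u01 p) (u00 b + u01 q) + ip V2 (v21 n + v22 c) (v21 m + v22 d)
    = ip V0 a b + ip V2 c d"
proof -
  have "ip V0 (u00 a + u01 p) (u00 b + u01 q) + ip V1 n m = ip V0 a b + ip V1 p q"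
    using u_ip[of a p b q] assms unfolding linked_def by metis
  moreover have "ip V1 p q + ip V2 (v21 n + v22 c) (v21 m + v22 d) = ip V1 n m + ip V2 c d"
    using v_ip[of n c m d] assms unfolding linked_def by metis
  ultimately have "(ip V0 (u00 a + u01 p) (u00 b + u01 q) + ip V1 n m)
      + (ip V1 p q + ip V2 (v21 n + v22 c) (v21 m + v22 d))
      = (ip V0 a b + ip V1 p q) + (ip V1 n m + ip V2 c d)"
    by (rule arg_cong2)
  then show ?thesis by (simp add: algebra_simps)
qed

text \<open>The vectors \<open>q\<close> and \<open>m\<close> solve the eliminated systems
  separately and need not be linked to each other. They differ from \<open>p\<close> and
  \<open>n\<close> by fixed vectors, which \<open>u01\<close> and \<open>v21\<close>
  annihilate.\<close>

lemma linked_unique: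
  assumes "linked a c p n" "q \<in> pos V1" "m \<in> neg V1"
    and "q - v11 (u11 q) = v11 (u10 a) + v12 c" "m - u11 (v11 m) = u10 a + u11 (v12 c)"
  shows "u01 q = u01 p" "v21 m = v21 n"
proof -
  have in1: "p \<in> pos V1" "n \<in> neg V1" using assms(1) unfolding linked_def by blast+
  have "q - v11 (u11 q) = p - v11 (u11 p)"
    unfolding assms(4) linked_equations(1)[OF assms(1)] ..
  then have "v11 (u11 q) - v11 (u11 p) = q - p" by (simp add: algebra_simps)
  then have "v11 (u11 (q - p)) = q - p"
    using assms(2) in1 by (simp add: blocks_diff blocks_diff')
  then have "u01 (q - p) = 0" using assms(2) in1 diff_in by (intro fixed_pos) auto
  then show "u01 q = u01 p" using assms(2) in1 by (simp add: blocks_diff)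
  have "m - u11 (v11 m) = n - u11 (v11 n)"
    unfolding assms(5) linked_equations(2)[OF assms(1)] ..
  then have "u11 (v11 m) - u11 (v11 n) = m - n" by (simp add: algebra_simps)
  then have "u11 (v11 (m - n)) = m - n"
    using assms(3) in1 by (simp add: blocks_diff blocks_diff')
  then have "v21 (m - n) = 0" using assms(3) in1 diff_in by (intro fixed_neg) auto
  then show "v21 m = v21 n" using assms(3) in1 by (simp add: blocks_diff')
qed

lemma relcomp_eq:
  "graph (\<Pi> V0 \<oplus> V1) (block u00 u01 u10 u11) O graph (\<Pi> V1 \<oplus> V2) (block v11 v12 v21 v22)
   = {(a + (u00 a + u01 p), c + (v21 n + v22 c)) | a c p n. linked a c p n}" (is "?L = ?R")
proof
  show "?R \<subseteq> ?L"
  proof clarify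
    fix a c p n assume l: "linked a c p n"
    let ?x1 = "p + n"
    have in': "a \<in> neg V0" "c \<in> pos V2" "p \<in> pos V1" "n \<in> neg V1"
      and n: "n = u10 a + u11 p" and p: "p = v11 n + v12 c"
      using l unfolding linked_def by blast+
    have "(a + (u00 a + u01 p), ?x1) \<in> graph (\<Pi> V0 \<oplus> V1) (block u00 u01 u10 u11)"
      unfolding graph_block_iff using in'(1,3) n by blast
    moreover have "(?x1, c + (v21 n + v22 c)) \<in> graph (\<Pi> V1 \<oplus> V2) (block v11 v12 v21 v22)"
      unfolding graph_block_iff using in'(2,4) p add.commute by metis
    ultimately show "(a + (u00 a + u01 p), c + (v21 n + v22 c)) \<in> ?L" by blast
  qed
  show "?L \<subseteq> ?R"
  proof clarify
    fix x0 x1 x2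
    assume *: "(x0, x1) \<in> graph (\<Pi> V0 \<oplus> V1) (block u00 u01 u10 u11)"
      "(x1, x2) \<in> graph (\<Pi> V1 \<oplus> V2) (block v11 v12 v21 v22)"
    obtain a p where 1: "a \<in> neg V0" "p \<in> pos V1"
      "x0 = a + (u00 a + u01 p)" "x1 = p + (u10 a + u11 p)"
      using *(1)[unfolded graph_block_iff] by (elim bexE conjE)
    obtain n c where 2: "n \<in> neg V1" "c \<in> pos V2"
      "x1 = n + (v11 n + v12 c)" "x2 = c + (v21 n + v22 c)"
      using *(2)[unfolded graph_block_iff] by (elim bexE conjE)
    note * = 1(1,2) 2(1,2) 1(3,4) 2(3,4)
    have eq: "p + (u10 a + u11 p) = (v11 n + v12 c) + n" using *(6,7) by (simp add: add.commute)
    have in': "u10 a + u11 p \<in> neg V1" "v11 n + v12 c \<in> pos V1" using * add_in by auto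
    \<comment> \<open>The middle vector has two splittings into a positive and a negative part.
      Applying the grading to both gives a second equation, and adding the two isolates
      \<open>p\<close>.\<close>
    have eq': "p - (u10 a + u11 p) = (v11 n + v12 c) - n"
      using grading_eq[OF V1 *(2) in'(1)] grading_eq[OF V1 in'(2) *(3)] eq by simp
    have "2 *\<^sub>R p = (p + (u10 a + u11 p)) + (p - (u10 a + u11 p))" by (simp add: scaleR_2)
    also have "\<dots> = ((v11 n + v12 c) + n) + ((v11 n + v12 c) - n)"
      by (rule arg_cong2[OF eq eq'])
    also have "\<dots> = 2 *\<^sub>R (v11 n + v12 c)" by (simp add: scaleR_2)
    finally have p: "p = v11 n + v12 c" by simp
    have "p + (u10 a + u11 p) = p + n" using eq by (simp only: p[symmetric])
    then have "n = u10 a + u11 p" by simp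
    then have "linked a c p n" using p *(1-4) unfolding linked_def by blast
    then show "\<exists>a c p n. (x0, x2) = (a + (u00 a + u01 p), c + (v21 n + v22 c)) \<and> linked a c p n"
      using * by blast
  qed
qed

text \<open>By \<open>orthogonal_fixed\<close> the right-hand side is orthogonal to the fixed
  vectors, and a closed range consists of all such vectors.\<close>

lemma linked_exists:
  assumes "contraction_pair polar (pos V1) (\<lambda>x. v11 (u11 x)) T'"
    and cl: "closed ((\<lambda>x. x - v11 (u11 x)) ` pos V1)"
    and ac: "a \<in> neg V0" "c \<in> pos V2"
  shows "\<exists>p n. linked a c p n"
proof -
  interpret C: contraction_pair polar "pos V1" "\<lambda>x. v11 (u11 x)" T' by fact
  let ?z = "v11 (u10 a) + v12 c"
  have "?z \<in> C.fixed_perp"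
    using ac add_in orthogonal_fixed by (auto simp: C.fixed_perp_def C.fixed_space_def intro!: H1.polar_eq_0)
  then have "?z \<in> (\<lambda>x. x - v11 (u11 x)) ` pos V1" using C.closed_range_eq[OF cl] by simp
  then obtain p where "p \<in> pos V1" "p - v11 (u11 p) = ?z" by force
  then show ?thesis using linkedI[OF ac] by blast
qed

lemma linked_add:
  assumes "linked a c p n" "linked a' c' p' n'"
  shows "linked (a + a') (c + c') (p + p') (n + n')"
proof -
  have *: "a \<in> neg V0" "c \<in> pos V2" "p \<in> pos V1" "n \<in> neg V1"
    "a' \<in> neg V0" "c' \<in> pos V2" "p' \<in> pos V1" "n' \<in> neg V1"
    using assms unfolding linked_def by blast+
  have "n + n' = (u10 a + u11 p) + (u10 a' + u11 p')" "p + p' = (v11 n + v12 c) + (v11 n' + v12 c')"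
    using assms unfolding linked_def by (metis arg_cong2)+
  moreover have "(u10 a + u11 p) + (u10 a' + u11 p') = u10 (a + a') + u11 (p + p')"
    "(v11 n + v12 c) + (v11 n' + v12 c') = v11 (n + n') + v12 (c + c')"
    using * by (simp_all add: blocks_add ac_simps)
  ultimately show ?thesis using * add_in unfolding linked_def by metis
qed

lemma linked_scale:
  assumes "linked a c p n"
  shows "linked (smul V0 k a) (smul V2 k c) (smul V1 k p) (smul V1 k n)"
proof -
  have *: "a \<in> neg V0" "c \<in> pos V2" "p \<in> pos V1" "n \<in> neg V1"
    using assms unfolding linked_def by blast+
  have "smul V1 k n = smul V1 k (u10 a + u11 p)" "smul V1 k p = smul V1 k (v11 n + v12 c)"
    using assms unfolding linked_def by metis+
  moreover have "smul V1 k (u10 a + u11 p) = u10 (smul V0 k a) + u11 (smul V1 k p)"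
    "smul V1 k (v11 n + v12 c) = v11 (smul V1 k n) + v12 (smul V2 k c)"
    using * by (simp_all add: blocks_scale H1.scale_right_distrib)
  ultimately show ?thesis using * scale_in unfolding linked_def by metis
qed

text \<open>The map \<open>w\<close> enters only through its values on linked tuples. These tuples
  are stable under sums and multiples and satisfy \<open>linked_ip\<close>, so \<open>w\<close>
  inherits linearity and isometry.\<close>

lemma composition_unitary:
  assumes ex: "\<And>a c. a \<in> neg V0 \<Longrightarrow> c \<in> pos V2 \<Longrightarrow> \<exists>p n. linked a c p n"
    and sur: "\<And>a' c'. a' \<in> pos V0 \<Longrightarrow> c' \<in> neg V2 \<Longrightarrow>
      \<exists>a c p n. linked a c p n \<and> a' = u00 a + u01 p \<and> c' = v21 n + v22 c"
    and w: "\<And>a c p n. linked a c p n \<Longrightarrow> w (a, c) = (u00 a + u01 p, v21 n + v22 c)"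
  shows "unitary_op (\<Pi> V0 \<oplus> V2) (neg V0 \<times> pos V2) (\<Pi> V0 \<oplus> V2) (pos V0 \<times> neg V2) w"
    and "graph (\<Pi> V0 \<oplus> V1) (block u00 u01 u10 u11) O graph (\<Pi> V1 \<oplus> V2) (block v11 v12 v21 v22)
      = graph (\<Pi> V0 \<oplus> V2) w"
proof -
  let ?S = "neg V0 \<times> pos V2" and ?T = "pos V0 \<times> neg V2"
  have linked_in: "a \<in> neg V0" "c \<in> pos V2" "p \<in> pos V1" "n \<in> neg V1" if "linked a c p n" for a c p n
    using that unfolding linked_def by blast+
  have ex': "\<exists>a c p n. x = (a, c) \<and> linked a c p n" if "x \<in> ?S" for x
    using ex that by (cases x) auto
  have into: "w x \<in> ?T" if x: "x \<in> ?S" for x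
  proof -
    obtain a c p n where l: "x = (a, c)" "linked a c p n" using ex'[OF x] by blast
    then show ?thesis using w[OF l(2)] linked_in[OF l(2)] add_in by simp
  qed
  have im: "w ` ?S = ?T"
  proof
    show "w ` ?S \<subseteq> ?T" using into by blast
    show "?T \<subseteq> w ` ?S"
    proof
      fix y assume "y \<in> ?T"
      then obtain a c p n where l: "linked a c p n" "y = (u00 a + u01 p, v21 n + v22 c)"
        using sur[of "fst y" "snd y"] by (auto simp: prod_eq_iff)
      then show "y \<in> w ` ?S" using w[OF l(1)] linked_in[OF l(1)] by (intro image_eqI[of _ _ "(a, c)"]) auto
    qed
  qed
  have add: "w (x + y) = w x + w y" if x: "x \<in> ?S" and y: "y \<in> ?S" for x y
  proof -
    obtain a c p n where l: "x = (a, c)" "linked a c p n" using ex'[OF x] by blast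
    obtain a' c' p' n' where l': "y = (a', c')" "linked a' c' p' n'" using ex'[OF y] by blast
    show ?thesis
      using w[OF l(2)] w[OF l'(2)] w[OF linked_add[OF l(2) l'(2)]] linked_in[OF l(2)] linked_in[OF l'(2)]
      by (simp add: l(1) l'(1) blocks_add ac_simps)
  qed
  have scale: "w (smul (\<Pi> V0 \<oplus> V2) k x) = smul (\<Pi> V0 \<oplus> V2) k (w x)" if x: "x \<in> ?S" for k x
  proof -
    obtain a c p n where l: "x = (a, c)" "linked a c p n" using ex'[OF x] by blast
    show ?thesis
      using w[OF l(2)] w[OF linked_scale[OF l(2)]] linked_in[OF l(2)]
      by (simp add: l(1) blocks_scale H0.scale_right_distrib H2.scale_right_distrib)
  qed
  have ip: "ip (\<Pi> V0 \<oplus> V2) (w x) (w y) = ip (\<Pi> V0 \<oplus> V2) x y" if x: "x \<in> ?S" and y: "y \<in> ?S" for x y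
  proof -
    obtain a c p n where l: "x = (a, c)" "linked a c p n" using ex'[OF x] by blast
    obtain a' c' p' n' where l': "y = (a', c')" "linked a' c' p' n'" using ex'[OF y] by blast
    show ?thesis using w[OF l(2)] w[OF l'(2)] linked_ip[OF l(2) l'(2)] by (simp add: l(1) l'(1))
  qed
  show "unitary_op (\<Pi> V0 \<oplus> V2) ?S (\<Pi> V0 \<oplus> V2) ?T w"
    unfolding unitary_op_def linear_op_def using into im add scale ip by blast
  have graph_w: "graph (\<Pi> V0 \<oplus> V2) w = {x + w x | x. x \<in> ?S}" by (simp add: graph_def)
  show "graph (\<Pi> V0 \<oplus> V1) (block u00 u01 u10 u11) O graph (\<Pi> V1 \<oplus> V2) (block v11 v12 v21 v22)
      = graph (\<Pi> V0 \<oplus> V2) w"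
    unfolding relcomp_eq graph_w
  proof (intro equalityI subsetI)
    fix z assume "z \<in> {(a + (u00 a + u01 p), c + (v21 n + v22 c)) | a c p n. linked a c p n}"
    then obtain a c p n where l: "linked a c p n" "z = (a + (u00 a + u01 p), c + (v21 n + v22 c))"
      by blast
    then have "z = (a, c) + w (a, c)" "(a, c) \<in> ?S" using w linked_in by simp_all
    then show "z \<in> {x + w x | x. x \<in> ?S}" by blast
  next
    fix z assume "z \<in> {x + w x | x. x \<in> ?S}"
    then obtain x where x: "x \<in> ?S" "z = x + w x" by blast
    obtain a c p n where l: "x = (a, c)" "linked a c p n" using ex'[OF x(1)] by blast
    then have "z = (a + (u00 a + u01 p), c + (v21 n + v22 c))" using x(2) w by simp
    then show "z \<in> {(a + (u00 a + u01 p), c + (v21 n + v22 c)) | a c p n. linked a c p n}"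
      using l(2) by blast
  qed
qed

text \<open>For linked data both right-hand sides lie in the ranges, so \<open>X\<close> and
  \<open>Y\<close> return solutions there. They may differ from \<open>p\<close> and
  \<open>n\<close>, but \<open>linked_unique\<close> shows that the outputs agree.\<close>

lemma block_generalized_inverse:
  assumes X: "generalized_inverse V1 (pos V1) V1 (pos V1) (\<lambda>x. x - v11 (u11 x)) X"
    and Y: "generalized_inverse V1 (neg V1) V1 (neg V1) (\<lambda>x. x - u11 (v11 x)) Y"
    and l: "linked a c p n"
  shows "block (\<lambda>x. u00 x + u01 (X (v11 (u10 x)))) (\<lambda>y. u01 (X (v12 y)))
      (\<lambda>x. v21 (Y (u10 x))) (\<lambda>y. v22 y + v21 (Y (u11 (v12 y)))) (a, c)
    = (u00 a + u01 p, v21 n + v22 c)"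
proof -
  have in': "a \<in> neg V0" "c \<in> pos V2" "p \<in> pos V1" "n \<in> neg V1"
    using l unfolding linked_def by blast+
  have XP: "X x \<in> pos V1" and X_add: "X (x + y) = X x + X y" if "x \<in> pos V1" "y \<in> pos V1" for x y
    using X that by (auto simp: generalized_inverse_def bounded_op_def linear_op_def)
  have AX: "X y - v11 (u11 (X y)) = y" if "y \<in> (\<lambda>x. x - v11 (u11 x)) ` pos V1" for y
    using X that unfolding generalized_inverse_def by blast
  have YN: "Y x \<in> neg V1" and Y_add: "Y (x + y) = Y x + Y y" if "x \<in> neg V1" "y \<in> neg V1" for x y
    using Y that by (auto simp: generalized_inverse_def bounded_op_def linear_op_def)
  have AY: "Y y - u11 (v11 (Y y)) = y" if "y \<in> (\<lambda>x. x - u11 (v11 x)) ` neg V1" for y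
    using Y that unfolding generalized_inverse_def by blast
  let ?z = "v11 (u10 a) + v12 c" and ?y = "u10 a + u11 (v12 c)"
  have "?z \<in> (\<lambda>x. x - v11 (u11 x)) ` pos V1" "?y \<in> (\<lambda>x. x - u11 (v11 x)) ` neg V1"
    unfolding linked_equations[OF l, symmetric] using in' by (intro imageI; simp)+
  then have "u01 (X ?z) = u01 p" "v21 (Y ?y) = v21 n"
    using linked_unique[OF l XP YN AX AY] in' add_in by auto
  moreover have "u01 (X ?z) = u01 (X (v11 (u10 a))) + u01 (X (v12 c))"
    using in' XP by (simp add: X_add blocks_add)
  moreover have "v21 (Y ?y) = v21 (Y (u10 a)) + v21 (Y (u11 (v12 c)))"
    using in' YN by (simp add: Y_add blocks_add)
  ultimately show ?thesis by (simp add: block_def ac_simps)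
qed

end

section \<open>Adjoints and surjectivity from the inverse unitaries\<close>

text \<open>
  The inverse unitaries run in the opposite direction, so they compose as in the previous locale
  once all parities are reversed.
\<close>

locale inverse_unitaries =
  composable_unitaries V0 V1 V2 u00 u01 u10 u11 v11 v12 v21 v22 +
  I: composable_unitaries "\<Pi> V0" "\<Pi> V1" "\<Pi> V2" u00' u01' u10' u11' v11' v12' v21' v22'
  for V0 :: "('k::real_or_complex, 'a::banach) super_space"
    and V1 :: "('k, 'b::banach) super_space"
    and V2 :: "('k, 'c::banach) super_space"
    and u00 u01 u10 u11 v11 v12 v21 v22 u00' u01' u10' u11' v11' v12' v21' v22' +
  assumes u_right: "y \<in> pos V0 \<times> neg V1 \<Longrightarrow>
      block u00 u01 u10 u11 (block u00' u01' u10' u11' y) = y"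
    and v_right: "z \<in> pos V1 \<times> neg V2 \<Longrightarrow>
      block v11 v12 v21 v22 (block v11' v12' v21' v22' z) = z"
begin

text \<open>The unitary \<open>u\<close> sends \<open>(u01' n, u11' n)\<close> to
  \<open>(0, n)\<close>; compare its inner product with that of the image of
  \<open>(0, p)\<close>.\<close>

lemma u11_adjoint: "p \<in> pos V1 \<Longrightarrow> n \<in> neg V1 \<Longrightarrow> ip V1 (u11 p) n = ip V1 p (u11' n)"
  using u_ip[of 0 p "u01' n" "u11' n"] u_right[of "(0, n)"] I.blocks_in(2,4)[of n]
  by (simp add: block_def)

lemma v11_adjoint: "n \<in> neg V1 \<Longrightarrow> p \<in> pos V1 \<Longrightarrow> ip V1 (v11 n) p = ip V1 n (v11' p)"
  using v_ip[of n 0 "v11' p" "v21' p"] v_right[of "(p, 0)"] I.blocks_in(5,7)[of p]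
  by (simp add: block_def)

text \<open>The adjoint of a product is the product of adjoint corners in reverse order, and a
  corner of a unitary is a contraction.\<close>

lemma contraction_pair_pos:
  "contraction_pair polar (pos V1) (\<lambda>x. v11 (u11 x)) (\<lambda>x. u11' (v11' x))"
proof -
  interpret real_inner_form "polar :: 'b \<Rightarrow> _" by (rule H1.real_inner_form_polar)
  note I_in = I.blocks_in[simplified] and I_add = I.blocks_add[simplified]
    and I_scale = I.blocks_scale[simplified]
  show ?thesis
  proof
    fix x y assume xy: "x \<in> pos V1" "y \<in> pos V1"
    show "polar (v11 (u11 x)) y = polar x (u11' (v11' y))"
      using xy by (intro H1.inner_prod_eq_polar_eq) (simp add: v11_adjoint u11_adjoint I_in)
  next
    fix x assume x: "x \<in> pos V1"
    show "norm (v11 (u11 x)) \<le> norm x"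
      using order_trans[OF v11_norm[of "u11 x"] u11_norm[of x]] x by simp
    show "norm (u11' (v11' x)) \<le> norm x"
      using order_trans[OF I.u11_norm[of "v11' x"] I.v11_norm[of x]] x by (simp add: I_in)
  qed (use closed_pos[OF V1] H1.real_subspace[OF sub(3)] in
      \<open>simp_all add: I_in blocks_add I_add flip: H1.scale_of_real\<close>,
      simp_all add: blocks_scale I_scale I_in)
qed

lemma contraction_pair_neg:
  "contraction_pair polar (neg V1) (\<lambda>x. u11 (v11 x)) (\<lambda>x. v11' (u11' x))"
proof -
  interpret real_inner_form "polar :: 'b \<Rightarrow> _" by (rule H1.real_inner_form_polar)
  note I_in = I.blocks_in[simplified] and I_add = I.blocks_add[simplified]
    and I_scale = I.blocks_scale[simplified]
  show ?thesis
  proof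
    fix x y assume xy: "x \<in> neg V1" "y \<in> neg V1"
    show "polar (u11 (v11 x)) y = polar x (v11' (u11' y))"
      using xy by (intro H1.inner_prod_eq_polar_eq) (simp add: v11_adjoint u11_adjoint I_in)
  next
    fix x assume x: "x \<in> neg V1"
    show "norm (u11 (v11 x)) \<le> norm x"
      using order_trans[OF u11_norm[of "v11 x"] v11_norm[of x]] x by simp
    show "norm (v11' (u11' x)) \<le> norm x"
      using order_trans[OF I.v11_norm[of "u11' x"] I.u11_norm[of x]] x by (simp add: I_in)
  qed (use closed_neg[OF V1] H1.real_subspace[OF sub(4)] in
      \<open>simp_all add: I_in blocks_add I_add flip: H1.scale_of_real\<close>,
      simp_all add: blocks_scale I_scale I_in)
qed

text \<open>A linked tuple for the inverse unitaries, read backwards: its outputs become inputs, and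
  the prescribed \<open>(a', c')\<close> is recovered as output. This turns existence for the
  inverses into surjectivity of the composite.\<close>

lemma linked_of_inverse:
  assumes "I.linked a' c' n p"
  shows "linked (u00' a' + u01' n) (v21' p + v22' c') p n"
    and "u00 (u00' a' + u01' n) + u01 p = a'" and "v21 n + v22 (v21' p + v22' c') = c'"
proof -
  have in': "a' \<in> pos V0" "c' \<in> neg V2" "n \<in> neg V1" "p \<in> pos V1"
    and p: "p = u10' a' + u11' n" and n: "n = v11' p + v12' c'"
    using assms unfolding I.linked_def parity_simps by blast+
  have 1: "block u00 u01 u10 u11 (u00' a' + u01' n, p) = (a', n)"
    using u_right[of "(a', n)"] in' by (simp add: block_def flip: p)
  have 2: "block v11 v12 v21 v22 (n, v21' p + v22' c') = (p, c')"
    using v_right[of "(p, c')"] in' by (simp add: block_def flip: n)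
  have "u00' a' + u01' n \<in> neg V0" "v21' p + v22' c' \<in> pos V2"
    using in' I.blocks_in add_in by simp_all
  then show "linked (u00' a' + u01' n) (v21' p + v22' c') p n"
    using 1 2 in' unfolding linked_def block_def prod.case by (metis prod.inject)
  show "u00 (u00' a' + u01' n) + u01 p = a'" "v21 n + v22 (v21' p + v22' c') = c'"
    using 1 2 by (simp_all add: block_def)
qed

end

theorem theorem2p20:
  fixes V0 :: "('k::real_or_complex, 'a::banach) super_space"
    and V1 :: "('k, 'b::banach) super_space"
    and V2 :: "('k, 'c::banach) super_space"
    and L01 :: "('a \<times> 'b) set" and L12 :: "('b \<times> 'c) set"
    and u00 :: "'a \<Rightarrow> 'a" and u01 :: "'b \<Rightarrow> 'a" and u10 :: "'a \<Rightarrow> 'b" and u11 :: "'b \<Rightarrow> 'b"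
    and v11 :: "'b \<Rightarrow> 'b" and v12 :: "'c \<Rightarrow> 'b" and v21 :: "'b \<Rightarrow> 'c" and v22 :: "'c \<Rightarrow> 'c"
  assumes "super_hilbert V0" and "super_hilbert V1" and "super_hilbert V2"
    and "lagrangian_relation V0 V1 L01" and "lagrangian_relation V1 V2 L12"
    and "bounded_op V0 (neg V0) V0 (pos V0) u00" and "bounded_op V1 (pos V1) V0 (pos V0) u01"
    and "bounded_op V0 (neg V0) V1 (neg V1) u10" and "bounded_op V1 (pos V1) V1 (neg V1) u11"
    and "bounded_op V1 (neg V1) V1 (pos V1) v11" and "bounded_op V2 (pos V2) V1 (pos V1) v12"
    and "bounded_op V1 (neg V1) V2 (neg V2) v21" and "bounded_op V2 (pos V2) V2 (neg V2) v22"
    and "unitary_op (\<Pi> V0 \<oplus> V1) (neg V0 \<times> pos V1) (\<Pi> V0 \<oplus> V1) (pos V0 \<times> neg V1)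
           (block u00 u01 u10 u11)"
    and "L01 = graph (\<Pi> V0 \<oplus> V1) (block u00 u01 u10 u11)"
    and "unitary_op (\<Pi> V1 \<oplus> V2) (neg V1 \<times> pos V2) (\<Pi> V1 \<oplus> V2) (pos V1 \<times> neg V2)
           (block v11 v12 v21 v22)"
    and "L12 = graph (\<Pi> V1 \<oplus> V2) (block v11 v12 v21 v22)"
    and "closed ((\<lambda>x. x - v11 (u11 x)) ` pos V1)"
    and "closed ((\<lambda>x. x - u11 (v11 x)) ` neg V1)"
  shows "lagrangian (\<Pi> V0 \<oplus> V2) (L01 O L12) \<and>
    (\<exists>X. generalized_inverse V1 (pos V1) V1 (pos V1) (\<lambda>x. x - v11 (u11 x)) X) \<and>
    (\<exists>Y. generalized_inverse V1 (neg V1) V1 (neg V1) (\<lambda>x. x - u11 (v11 x)) Y) \<and>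
    (\<forall>X Y. generalized_inverse V1 (pos V1) V1 (pos V1) (\<lambda>x. x - v11 (u11 x)) X \<longrightarrow>
       generalized_inverse V1 (neg V1) V1 (neg V1) (\<lambda>x. x - u11 (v11 x)) Y \<longrightarrow>
       (let w = block (\<lambda>x. u00 x + u01 (X (v11 (u10 x)))) (\<lambda>y. u01 (X (v12 y)))
                      (\<lambda>x. v21 (Y (u10 x))) (\<lambda>y. v22 y + v21 (Y (u11 (v12 y))))
        in unitary_op (\<Pi> V0 \<oplus> V2) (neg V0 \<times> pos V2) (\<Pi> V0 \<oplus> V2) (pos V0 \<times> neg V2) w \<and>
           L01 O L12 = graph (\<Pi> V0 \<oplus> V2) w))"
proof -
  note V0 = assms(1) and V1 = assms(2) and V2 = assms(3) and cl = assms(18,19)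
  obtain u00' u01' u10' u11' where u':
    "linear_op V0 (pos V0) V0 (neg V0) u00'" "linear_op V1 (neg V1) V0 (neg V0) u01'"
    "linear_op V0 (pos V0) V1 (pos V1) u10'" "linear_op V1 (neg V1) V1 (pos V1) u11'"
    "unitary_op (\<Pi> (\<Pi> V0) \<oplus> \<Pi> V1) (pos V0 \<times> neg V1) (\<Pi> (\<Pi> V0) \<oplus> \<Pi> V1) (neg V0 \<times> pos V1)
      (block u00' u01' u10' u11')"
    "\<And>y. y \<in> pos V0 \<times> neg V1 \<Longrightarrow> block u00 u01 u10 u11 (block u00' u01' u10' u11' y) = y"
    using unitary_block_inverse[OF V0 V1 assms(14)] by metis
  obtain v11' v12' v21' v22' where v':
    "linear_op V1 (pos V1) V1 (neg V1) v11'" "linear_op V2 (neg V2) V1 (neg V1) v12'"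
    "linear_op V1 (pos V1) V2 (pos V2) v21'" "linear_op V2 (neg V2) V2 (pos V2) v22'"
    "unitary_op (\<Pi> (\<Pi> V1) \<oplus> \<Pi> V2) (pos V1 \<times> neg V2) (\<Pi> (\<Pi> V1) \<oplus> \<Pi> V2) (neg V1 \<times> pos V2)
      (block v11' v12' v21' v22')"
    "\<And>y. y \<in> pos V1 \<times> neg V2 \<Longrightarrow> block v11 v12 v21 v22 (block v11' v12' v21' v22' y) = y"
    using unitary_block_inverse[OF V1 V2 assms(16)] by metis
  interpret inverse_unitaries V0 V1 V2 u00 u01 u10 u11 v11 v12 v21 v22
    u00' u01' u10' u11' v11' v12' v21' v22'
    by unfold_locales
      (use assms(1-14,16) u' v' in \<open>simp_all only: bounded_op_def super_hilbert_parity
        linear_op_parity parity_simps\<close>)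
  have ex: "\<exists>p n. linked a c p n" if "a \<in> neg V0" "c \<in> pos V2" for a c
    using linked_exists[OF contraction_pair_pos cl(1) that] .
  \<comment> \<open>Solving the inverse system requires closed range of 1 - \<open>v11'\<close>
    \<open>u11'\<close> on \<open>neg V1\<close>. This is the adjoint of 1 - \<open>u11\<close>
    \<open>v11\<close>, whose range is closed by hypothesis.\<close>
  have sur: "\<exists>a c p n. linked a c p n \<and> a' = u00 a + u01 p \<and> c' = v21 n + v22 c"
    if ac: "a' \<in> pos V0" "c' \<in> neg V2" for a' c'
  proof -
    have "\<exists>n p. I.linked a' c' n p"
      using contraction_pair.closed_range_adjoint[OF contraction_pair_neg cl(2)]
        contraction_pair.swap[OF contraction_pair_neg] ac by (intro I.linked_exists) simp_all
    then show ?thesis using linked_of_inverse by metis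
  qed
  have gi: "\<exists>X. generalized_inverse V1 (pos V1) V1 (pos V1) (\<lambda>x. x - v11 (u11 x)) X"
    "\<exists>Y. generalized_inverse V1 (neg V1) V1 (neg V1) (\<lambda>x. x - u11 (v11 x)) Y"
    by (rule generalized_inverse_exists[OF H1.hilbert_space_axioms sub(3) contraction_pair_pos _ cl(1)];
          simp add: blocks_scale)
       (rule generalized_inverse_exists[OF H1.hilbert_space_axioms sub(4) contraction_pair_neg _ cl(2)];
          simp add: blocks_scale)
  define w where "w X Y = block (\<lambda>x. u00 x + u01 (X (v11 (u10 x)))) (\<lambda>y. u01 (X (v12 y)))
      (\<lambda>x. v21 (Y (u10 x))) (\<lambda>y. v22 y + v21 (Y (u11 (v12 y))))" for X Y
  have w: "unitary_op (\<Pi> V0 \<oplus> V2) (neg V0 \<times> pos V2) (\<Pi> V0 \<oplus> V2) (pos V0 \<times> neg V2) (w X Y)"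
    "L01 O L12 = graph (\<Pi> V0 \<oplus> V2) (w X Y)"
    if "generalized_inverse V1 (pos V1) V1 (pos V1) (\<lambda>x. x - v11 (u11 x)) X"
      "generalized_inverse V1 (neg V1) V1 (neg V1) (\<lambda>x. x - u11 (v11 x)) Y" for X Y
    unfolding assms(15,17) w_def
    using composition_unitary[OF ex sur block_generalized_inverse[OF that]] by blast+
  \<comment> \<open>Choosing any generalized inverses exhibits the composition as the graph of a
    unitary, and such a graph is Lagrangian.\<close>
  have "lagrangian (\<Pi> V0 \<oplus> V2) (L01 O L12)"
  proof -
    obtain X Y where "generalized_inverse V1 (pos V1) V1 (pos V1) (\<lambda>x. x - v11 (u11 x)) X"
      "generalized_inverse V1 (neg V1) V1 (neg V1) (\<lambda>x. x - u11 (v11 x)) Y"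
      using gi by blast
    from w[OF this] show ?thesis
      using lagrangian_graph[OF super_hilbert_direct_sum[OF super_hilbert_parity[OF V0] V2], of "w X Y"]
      by simp
  qed
  then show ?thesis using gi w unfolding w_def[symmetric] Let_def by blast
qed

end
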